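(* For any Borel probability measure $\mu$ on $\mathbb{R}$ with mean $0$ and variance $1$, the measures $D_{\sqrt{1+t}}\big(\mathbb{B}_t(\mu)\big)$ converge weakly to $\mu_{C_1}$ as $t\to\infty$ (through real values $t\ge 0$), where $\mathbb{B}_t(\mu)=(\mu^{\boxplus(1+t)})^{\uplus\frac{1}{1+t}}$ is the Belinschi–Nica semigroup and $\mu_{C_1}$ is the Cauchy distribution with parameter $1$.
   Context: Let $\mathcal{P}$ be the set of Borel probability measures on $\mathbb{R}$ and $\mathbb{C}^+$ the open complex upper half-plane. Dilation: for $\mu\in\mathcal{P}$ and $c\ne 0$, $D_c(\mu)(B):=\mu(c^{-1}B)$ for Borel $B\subset\mathbb{R}$ (push-forward under $x\mapsto cx$). Transforms: for $\mu\in\mathcal{P}$, the Cauchy transform is $G_\mu(z)=\int_{\mathbb{R}}\frac{1}{z-x}\,\mu(dx)$ and the F-transform is $F_\mu(z)=1/G_\mu(z)$, for $z\in\mathbb{C}^+$; $F_\mu$ is analytic and maps $\mathbb{C}^+$ into itself, and $F_\mu$ determines $\mu$. Free convolution power: for $\lambda,R>0$ let $\Gamma_{\lambda,R}=\{z\in\mathbb{C}^+:|\mathrm{Re}\,z|<\lambda\,\mathrm{Im}\,z,\ \mathrm{Im}\,z>R\}$. For every $\mu\in\mathcal{P}$ there are $\lambda,R>0$ such that $F_\mu$ has an analytic right inverse $F_\mu^{\langle-1\rangle}:\Gamma_{\lambda,R}\to\mathbb{C}^+$ (so $F_\mu(F_\mu^{\langle-1\rangle}(z))=z$ on $\Gamma_{\lambda,R}$)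 with $F_\mu^{\langle-1\rangle}(z)=z(1+o(1))$ as $z\to\infty$ non-tangentially (i.e. within a cone $|\mathrm{Re}\,z|<\beta\,\mathrm{Im}\,z$, $\beta>0$). The Voiculescu transform of $\mu$ is $\varphi_\mu(z)=F_\mu^{\langle-1\rangle}(z)-z$ on $\Gamma_{\lambda,R}$. Additive free convolution $\boxplus$ satisfies $\varphi_{\mu\boxplus\nu}=\varphi_\mu+\varphi_\nu$ on some $\Gamma_{\lambda,R}$. For $\mu\in\mathcal{P}$ and real $s\ge 1$, the additive free convolution power $\mu^{\boxplus s}\in\mathcal{P}$ is the probability measure with $\varphi_{\mu^{\boxplus s}}=s\,\varphi_\mu$ on some domain $\Gamma_{\lambda,R}$ (it is known to exist for every $\mu\in\mathcal{P}$ and every real $s\ge1$). Boolean convolution power: for $\mu\in\mathcal{P}$ and real $s>0$, $\mu^{\uplus s}\in\mathcal{P}$ is the probability measure determined by $F_{\mu^{\uplus s}}(z)=sF_\mu(z)+(1-s)z$ for $z\in\mathbb{C}^+$ (it is known to exist for every $\mu\in\mathcal{P}$ and every real $s>0$). Belinschi–Nica semigroup: for $t\ge 0$ and $\mu\in\mathcal{P}$, $\mathbb{B}_t(\mu):=(\mu^{\boxplus(1+t)})^{\uplus\frac{1}{1+t}}$. Cauchy distribution with parameter $1$: $\mu_{C_1}(dx)=\frac{1}{\pi(x^2+1)}\,dx$. *)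

theory Defs
  imports "HOL-Probability.Probability"
begin

text \<open>
  Borel probability measures on the real line are the measures \<open>\<mu>\<close> with
  \<^term>\<open>real_distribution \<mu>\<close>.
\<close>

definition upper_half_plane :: "complex set" where
  "upper_half_plane = {z. 0 < Im z}"

definition truncated_cone :: "real \<Rightarrow> real \<Rightarrow> complex set" where
  "truncated_cone \<kappa> R = {z \<in> upper_half_plane. \<bar>Re z\<bar> < \<kappa> * Im z \<and> R < Im z}"

definition cauchy_transform :: "real measure \<Rightarrow> complex \<Rightarrow> complex" where
  "cauchy_transform \<mu> z = (\<integral>x. 1 / (z - complex_of_real x) \<partial>\<mu>)"

definition F_transform :: "real measure \<Rightarrow> complex \<Rightarrow> complex" where
  "F_transform \<mu> z = 1 / cauchy_transform \<mu> z"

text \<open>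
  The last condition is \<open>f z = z (1 + o(1))\<close> as \<open>z \<rightarrow> \<infinity>\<close> non-tangentially.
\<close>

definition is_F_right_inverse ::
  "real measure \<Rightarrow> real \<Rightarrow> real \<Rightarrow> (complex \<Rightarrow> complex) \<Rightarrow> bool" where
  "is_F_right_inverse \<mu> \<kappa> R f \<longleftrightarrow>
     f analytic_on truncated_cone \<kappa> R \<and>
     f ` truncated_cone \<kappa> R \<subseteq> upper_half_plane \<and>
     (\<forall>z\<in>truncated_cone \<kappa> R. F_transform \<mu> (f z) = z) \<and>
     (\<forall>\<beta>>0. ((\<lambda>z. f z / z) \<longlongrightarrow> 1)
        (inf at_infinity (principal {z \<in> truncated_cone \<kappa> R. \<bar>Re z\<bar> < \<beta> * Im z})))"

definition is_voiculescu_transform ::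
  "real measure \<Rightarrow> real \<Rightarrow> real \<Rightarrow> (complex \<Rightarrow> complex) \<Rightarrow> bool" where
  "is_voiculescu_transform \<mu> \<kappa> R \<phi> \<longleftrightarrow>
     (\<exists>f. is_F_right_inverse \<mu> \<kappa> R f \<and> (\<forall>z\<in>truncated_cone \<kappa> R. \<phi> z = f z - z))"

definition is_free_power :: "real \<Rightarrow> real measure \<Rightarrow> real measure \<Rightarrow> bool" where
  "is_free_power s \<mu> \<nu> \<longleftrightarrow> real_distribution \<nu> \<and>
     (\<exists>\<kappa>>0. \<exists>R>0. \<exists>\<phi> \<psi>. is_voiculescu_transform \<mu> \<kappa> R \<phi> \<and> is_voiculescu_transform \<nu> \<kappa> R \<psi> \<and>
        (\<forall>z\<in>truncated_cone \<kappa> R. \<psi> z = of_real s * \<phi> z))"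

definition is_boolean_power :: "real \<Rightarrow> real measure \<Rightarrow> real measure \<Rightarrow> bool" where
  "is_boolean_power s \<mu> \<nu> \<longleftrightarrow> real_distribution \<nu> \<and>
     (\<forall>z\<in>upper_half_plane. F_transform \<nu> z = of_real s * F_transform \<mu> z + of_real (1 - s) * z)"

text \<open>
  For every Borel probability measure \<open>\<mu>\<close> a free power exists for all \<open>s \<ge> 1\<close>, a Boolean power
  for all \<open>s > 0\<close>, and each is unique; the choice operators below therefore select that measure.
  For other \<open>s\<close> the values are unspecified.
\<close>

definition free_power :: "real measure \<Rightarrow> real \<Rightarrow> real measure" where
  "free_power \<mu> s = (SOME \<nu>. is_free_power s \<mu> \<nu>)"

definition boolean_power :: "real measure \<Rightarrow> real \<Rightarrow> real measure" where
  "boolean_power \<mu> s = (SOME \<nu>. is_boolean_power s \<mu> \<nu>)"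

definition belinschi_nica :: "real \<Rightarrow> real measure \<Rightarrow> real measure" where
  "belinschi_nica t \<mu> = boolean_power (free_power \<mu> (1 + t)) (1 / (1 + t))"

definition dilation :: "real \<Rightarrow> real measure \<Rightarrow> real measure" where
  "dilation c \<mu> = distr \<mu> borel (\<lambda>x. c * x)"

definition standard_cauchy_distribution :: "real measure" where
  "standard_cauchy_distribution = density lborel (\<lambda>x. ennreal (1 / (pi * (x\<^sup>2 + 1))))"

text \<open>
  The library's \<^const>\<open>weak_conv_m\<close> covers sequences of measures only; here the
  index may run along an arbitrary filter, in particular through the reals to infinity.
\<close>

definition converges_weakly ::
  "('i \<Rightarrow> real measure) \<Rightarrow> real measure \<Rightarrow> 'i filter \<Rightarrow> bool" where
  "converges_weakly N M F \<longleftrightarrow>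
     (\<forall>f :: real \<Rightarrow> real. continuous_on UNIV f \<and> bounded (range f) \<longrightarrow>
        ((\<lambda>i. \<integral>x. f x \<partial>(N i)) \<longlongrightarrow> (\<integral>x. f x \<partial>M)) F)"

end

theory Submission
  imports Defs "HOL-Complex_Analysis.Complex_Analysis" "HOL-Real_Asymp.Real_Asymp"
begin

text \<open>
  Write \<open>K z = F z - z\<close> for the standardized law \<open>\<mu>\<close>. The Hilbert space vectors
  \<open>b z = F z / (z - x) - 1\<close> satisfy \<open>E (b z) = 0\<close>, \<open>E \<bar>b z\<bar>\<^sup>2 = Im (K z) / Im z\<close>,
  \<open>K z - K w = (z - w) E (b z * b w)\<close> and \<open>K z = - E (x * b z)\<close>, so
  Cauchy-Schwarz controls \<open>K\<close>. By Brouwer's theorem and this control \<open>w = z + t K w\<close> has exactly one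
  solution \<open>w = \<omega> t z\<close> in the upper half-plane; the free power of order \<open>1 + t\<close> has F-transform \<open>F (\<omega> t z)\<close>, and the Belinschi-Nica
  law has F-transform \<open>z + K (\<omega> t z)\<close>. With \<open>c = sqrt (1 + t)\<close> and \<open>w = \<omega> t (z / c)\<close> one has
  \<open>w K w \<rightarrow> - 1\<close>, hence \<open>(w / c)\<^sup>2 \<rightarrow> - 1\<close>, \<open>w / c \<rightarrow> \<i>\<close> and \<open>c K w \<rightarrow> \<i>\<close>: the rescaled F-transforms tend
  to \<open>z + \<i>\<close>, the F-transform of the Cauchy law. That the powers exist as measures comes from a
  Nevanlinna-type theorem obtained from the Poisson formula and Helly selection.
\<close>

subsection \<open>Cauchy and F-transforms\<close>

text \<open>The obstacle is that the solutions \<open>w\<close> are not known in advance to stay in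
  a cone, so no non-tangential expansion of \<open>K\<close> at infinity applies to them. What
  replaces it is an inequality blind to direction: imaginary parts in \<open>w = z + t K w\<close>
  give \<open>t * Im (K w) < Im w\<close>, that is,
  \<open>E \<bar>b w\<bar>\<^sup>2 < 1 / t\<close>. It makes the solution unique, and with
  \<open>\<bar>w\<bar> = O(sqrt t)\<close> it keeps \<open>w * b w\<close> bounded in mean square;
  as \<open>w * b w\<close> tends to \<open>x\<close> pointwise once \<open>\<bar>w\<bar>\<close>
  tends to infinity, \<open>w * K w = - E (x * w * b w)\<close> tends to
  \<open>- E (x\<^sup>2)\<close>. That \<open>\<bar>w\<bar>\<close> escapes follows from
  \<open>K w + x = (w - x) * b w\<close>: for bounded \<open>w\<close> the right side would be small
  in mean, whereas \<open>E \<bar>x\<bar> > 0\<close>. The powers are picked by choice operators, so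
  existence is not enough: every measure satisfying the definition of a free power must be shown to
  have the expected F-transform, although that definition speaks only about a truncated
  cone.\<close>

lemma upper_half_plane_iff [simp]: "z \<in> upper_half_plane \<longleftrightarrow> 0 < Im z"
  by (simp add: upper_half_plane_def)

lemma open_upper_half_plane: "open upper_half_plane"
  by (simp add: upper_half_plane_def open_halfspace_Im_gt)

lemma connected_upper_half_plane: "connected upper_half_plane"
  by (simp add: upper_half_plane_def convex_halfspace_Im_gt convex_connected)

lemma diff_of_real_neq_0: "Im z \<noteq> 0 \<Longrightarrow> z - complex_of_real x \<noteq> 0"
  by (auto simp: complex_eq_iff)

lemma norm_resolvent_le: "0 < Im z \<Longrightarrow> cmod (1 / (z - complex_of_real x)) \<le> 1 / Im z"
  using abs_Im_le_cmod[of "z - of_real x"]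
  by (auto simp: norm_divide intro!: divide_left_mono mult_pos_pos)

section \<open>Expectation bounds and the Cauchy-Schwarz inequality\<close>

lemma (in prob_space) norm_expectation_le:
  fixes f :: "'a \<Rightarrow> 'b::{banach, second_countable_topology}"
  assumes "\<And>x. norm (f x) \<le> B"
  shows "norm (expectation f) \<le> B"
proof (cases "integrable M f")
  case True
  have "norm (expectation f) \<le> (\<integral>x. norm (f x) \<partial>M)" by (rule integral_norm_bound)
  also have "\<dots> \<le> B" by (rule integral_le_const) (use True assms in auto)
  finally show ?thesis .
next
  \<comment> \<open>A non-integrable function has Bochner integral 0 by convention, so
    \<open>0 \<le> B\<close> is enough here.\<close>
  case False
  have "0 \<le> B" using assms norm_ge_zero order_trans by blast
  then show ?thesis using False by (simp add: not_integrable_integral_eq)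
qed

text \<open>The pairing is bilinear, without a conjugate, because differences of F-transforms
  produce \<open>E (b z * b w)\<close>.\<close>

lemma
  fixes f g :: "'a \<Rightarrow> 'b::{banach, second_countable_topology, real_normed_field}"
  assumes [measurable]: "f \<in> borel_measurable M" "g \<in> borel_measurable M"
    and f: "integrable M (\<lambda>x. (norm (f x))\<^sup>2)" and g: "integrable M (\<lambda>x. (norm (g x))\<^sup>2)"
  shows integrable_mult_L2: "integrable M (\<lambda>x. f x * g x)"
    and Cauchy_Schwarz_integral:
      "(norm (\<integral>x. f x * g x \<partial>M))\<^sup>2 \<le> (\<integral>x. (norm (f x))\<^sup>2 \<partial>M) * (\<integral>x. (norm (g x))\<^sup>2 \<partial>M)"
proof -
  show i: "integrable M (\<lambda>x. f x * g x)"
  proof (rule Bochner_Integration.integrable_bound)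
    show "integrable M (\<lambda>x. (norm (f x))\<^sup>2 + (norm (g x))\<^sup>2)" using f g by simp
    have "norm (f x * g x) \<le> norm ((norm (f x))\<^sup>2 + (norm (g x))\<^sup>2)" for x
      using sum_squares_bound[of "norm (f x)" "norm (g x)"]
        mult_nonneg_nonneg[of "norm (f x)" "norm (g x)"]
      by (auto simp: norm_mult simp del: mult_nonneg_nonneg)
    then show "AE x in M. norm (f x * g x) \<le> norm ((norm (f x))\<^sup>2 + (norm (g x))\<^sup>2)" by simp
  qed measurable
  have n: "integrable M (\<lambda>x. norm (f x) * norm (g x))"
    using integrable_norm[OF i] by (simp add: norm_mult)
  have "ennreal ((\<integral>x. norm (f x) * norm (g x) \<partial>M)\<^sup>2)
        = (\<integral>\<^sup>+x. ennreal (norm (f x)) * ennreal (norm (g x)) \<partial>M)\<^sup>2"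
    using n by (simp add: nn_integral_eq_integral ennreal_mult[symmetric] ennreal_power)
  also have "\<dots> \<le> (\<integral>\<^sup>+x. ennreal (norm (f x)) ^ 2 \<partial>M) * (\<integral>\<^sup>+x. ennreal (norm (g x)) ^ 2 \<partial>M)"
    by (rule Cauchy_Schwarz_nn_integral) auto
  also have "\<dots> = ennreal ((\<integral>x. (norm (f x))\<^sup>2 \<partial>M) * (\<integral>x. (norm (g x))\<^sup>2 \<partial>M))"
    using f g by (simp add: nn_integral_eq_integral ennreal_mult ennreal_power)
  finally have "(\<integral>x. norm (f x) * norm (g x) \<partial>M)\<^sup>2
      \<le> (\<integral>x. (norm (f x))\<^sup>2 \<partial>M) * (\<integral>x. (norm (g x))\<^sup>2 \<partial>M)"
    by (subst (asm) ennreal_le_iff) auto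
  moreover have "norm (\<integral>x. f x * g x \<partial>M) \<le> (\<integral>x. norm (f x) * norm (g x) \<partial>M)"
    using integral_norm_bound[of M "\<lambda>x. f x * g x"] by (simp add: norm_mult)
  ultimately show "(norm (\<integral>x. f x * g x \<partial>M))\<^sup>2
      \<le> (\<integral>x. (norm (f x))\<^sup>2 \<partial>M) * (\<integral>x. (norm (g x))\<^sup>2 \<partial>M)"
    by (meson norm_ge_zero order_trans power_mono)
qed

text \<open>The density of the Cauchy law of scale \<open>y\<close>. It is also
  \<open>- 1 / pi\<close> times the imaginary part of the resolvent, so integrals against it carry
  the same information as \<open>Im (cauchy_transform M z)\<close>.\<close>

definition poisson_kernel :: "real \<Rightarrow> real \<Rightarrow> real" where
  "poisson_kernel y u = y / (pi * (u\<^sup>2 + y\<^sup>2))"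

lemma poisson_kernel_measurable [measurable]: "poisson_kernel y \<in> borel_measurable borel"
  unfolding poisson_kernel_def by measurable

lemma poisson_kernel_pos: "0 < y \<Longrightarrow> 0 < poisson_kernel y u"
  unfolding poisson_kernel_def
  by (intro divide_pos_pos mult_pos_pos add_nonneg_pos) auto

lemma Im_resolvent:
  "Im (1 / (z - complex_of_real x)) = - pi * poisson_kernel (Im z) (Re z - x)"
  by (simp add: poisson_kernel_def Im_divide cmod_power2)

context real_distribution
begin

lemma prob_UNIV: "prob UNIV = 1"
  using prob_space by simp

lemma integrable_resolvent: "0 < Im z \<Longrightarrow> integrable M (\<lambda>x. 1 / (z - complex_of_real x))"
  by (rule integrable_const_bound[where B="1 / Im z"]) (use norm_resolvent_le in auto)

lemma Im_cauchy_transform: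
  assumes "0 < Im z"
  shows "Im (cauchy_transform M z) = - pi * (\<integral>x. poisson_kernel (Im z) (Re z - x) \<partial>M)"
    and "integrable M (\<lambda>x. poisson_kernel (Im z) (Re z - x))"
proof -
  have "integrable M (\<lambda>x. Im (1 / (z - complex_of_real x)))"
    using integrable_Im[OF integrable_resolvent[OF assms]] .
  then have "integrable M (\<lambda>x. (- pi) * poisson_kernel (Im z) (Re z - x))"
    unfolding Im_resolvent by simp
  then show "integrable M (\<lambda>x. poisson_kernel (Im z) (Re z - x))" by simp
  have "Im (cauchy_transform M z) = (\<integral>x. Im (1 / (z - complex_of_real x)) \<partial>M)"
    unfolding cauchy_transform_def by (rule integral_Im[symmetric, OF integrable_resolvent[OF assms]])
  then show "Im (cauchy_transform M z) = - pi * (\<integral>x. poisson_kernel (Im z) (Re z - x) \<partial>M)"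
    unfolding Im_resolvent by simp
qed

lemma Im_cauchy_transform_neg:
  assumes "0 < Im z" shows "Im (cauchy_transform M z) < 0"
proof -
  have "expectation (\<lambda>x. - poisson_kernel (Im z) (Re z - x)) < 0"
    using Im_cauchy_transform(2)[OF assms] poisson_kernel_pos[OF assms]
    by (intro expectation_less) auto
  then show ?thesis using Im_cauchy_transform(1)[OF assms] by (simp add: mult_pos_pos)
qed

lemma cauchy_transform_neq_0: "0 < Im z \<Longrightarrow> cauchy_transform M z \<noteq> 0"
  using Im_cauchy_transform_neg[of z] by auto

lemma norm_cauchy_transform_le: "0 < Im z \<Longrightarrow> cmod (cauchy_transform M z) \<le> 1 / Im z"
  unfolding cauchy_transform_def by (intro norm_expectation_le norm_resolvent_le)

text \<open>With \<open>R w = 1 / (w - x)\<close>, the difference quotient of \<open>R\<close>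
  differs from \<open>- (R z)\<^sup>2\<close> by exactly
  \<open>(w - z) * (R z)\<^sup>2 * R w\<close>. On the disc of radius \<open>Im z / 2\<close> this
  is bounded by a multiple of \<open>\<bar>w - z\<bar>\<close> uniformly in \<open>x\<close>, so the
  derivative passes through the expectation.\<close>

lemma holomorphic_cauchy_transform: "cauchy_transform M holomorphic_on upper_half_plane"
  unfolding holomorphic_on_open[OF open_upper_half_plane]
proof (intro ballI exI)
  fix z assume "z \<in> upper_half_plane"
  then have z: "0 < Im z" by simp
  let ?R = "\<lambda>w x. 1 / (w - complex_of_real x)"
  let ?D = "- expectation (\<lambda>x. ?R z x ^ 2)"
  have iz2: "integrable M (\<lambda>x. ?R z x ^ 2)"
  proof (rule integrable_const_bound)
    show "AE x in M. norm (?R z x ^ 2) \<le> (1 / Im z) ^ 2"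
      using power_mono[OF norm_resolvent_le[OF z] norm_ge_zero, of _ 2] by (auto simp: norm_power)
  qed measurable
  have est: "cmod ((cauchy_transform M w - cauchy_transform M z) / (w - z) - ?D)
      \<le> cmod (w - z) * (2 / Im z ^ 3)" if w: "w \<in> ball z (Im z / 2)" "w \<noteq> z" for w
  proof -
    have "\<bar>Im (z - w)\<bar> < Im z / 2"
      using abs_Im_le_cmod[of "z - w"] w by (simp add: dist_norm)
    then have Iw: "Im z / 2 < Im w" by (simp add: abs_if split: if_splits)
    then have Iw0: "0 < Im w" using z by simp
    have "(cauchy_transform M w - cauchy_transform M z) / (w - z) - ?D
      = (\<integral>x. (?R w x - ?R z x) / (w - z) + ?R z x ^ 2 \<partial>M)"
    proof -
      obtain p q where pq: "p = ?R w" "q = ?R z" by blast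
      have "integrable M p" "integrable M q" "integrable M (\<lambda>x. q x ^ 2)"
        unfolding pq using integrable_resolvent[OF Iw0] integrable_resolvent[OF z] iz2 by auto
      then have "(expectation p - expectation q) / (w - z) - - expectation (\<lambda>x. q x ^ 2)
          = (\<integral>x. (p x - q x) / (w - z) + q x ^ 2 \<partial>M)"
        by simp
      then show ?thesis unfolding cauchy_transform_def pq .
    qed
    also have "\<dots> = (\<integral>x. (w - z) * (?R z x ^ 2 * ?R w x) \<partial>M)"
    proof (rule Bochner_Integration.integral_cong[OF refl])
      fix x
      have "z - complex_of_real x \<noteq> 0" "w - complex_of_real x \<noteq> 0" "w - z \<noteq> 0"
        using diff_of_real_neq_0 z Iw0 w(2) by auto
      then show "(?R w x - ?R z x) / (w - z) + ?R z x ^ 2 = (w - z) * (?R z x ^ 2 * ?R w x)"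
        by (simp add: divide_simps power2_eq_square) (simp add: algebra_simps)
    qed
    also have "cmod \<dots> \<le> cmod (w - z) * (2 / Im z ^ 3)"
    proof (rule norm_expectation_le)
      fix x
      have "cmod (?R w x) \<le> 2 / Im z"
        using order_trans[OF norm_resolvent_le[OF Iw0], of "2 / Im z" x] Iw z
        by (auto simp: field_simps)
      moreover have "cmod (?R z x) ^ 2 \<le> (1 / Im z) ^ 2"
        by (intro power_mono norm_resolvent_le z) auto
      ultimately have "cmod (?R z x) ^ 2 * cmod (?R w x) \<le> (1 / Im z) ^ 2 * (2 / Im z)"
        by (intro mult_mono) auto
      then have "cmod (w - z) * (cmod (?R z x) ^ 2 * cmod (?R w x)) \<le> cmod (w - z) * ((1 / Im z) ^ 2 * (2 / Im z))"
        by (intro mult_left_mono) auto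
      also have "(1 / Im z) ^ 2 * (2 / Im z) = 2 / Im z ^ 3"
        by (simp add: power2_eq_square power3_eq_cube)
      finally show "cmod ((w - z) * (?R z x ^ 2 * ?R w x)) \<le> cmod (w - z) * (2 / Im z ^ 3)"
        by (simp only: norm_mult norm_power)
    qed
    finally show ?thesis .
  qed
  show "(cauchy_transform M has_field_derivative ?D) (at z)"
    unfolding has_field_derivative_iff
  proof (rule LIM_zero_cancel, rule Lim_null_comparison)
    have "\<forall>\<^sub>F w in at z. w \<in> ball z (Im z / 2)"
      using z by (intro eventually_at_in_open') auto
    then show "\<forall>\<^sub>F w in at z. norm ((cauchy_transform M w - cauchy_transform M z) / (w - z) - ?D)
        \<le> cmod (w - z) * (2 / Im z ^ 3)"
      using eventually_neq_at_within[of z z UNIV] by eventually_elim (use est in auto)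
    have "((\<lambda>w. cmod (w - z) * (2 / Im z ^ 3)) \<longlongrightarrow> cmod (z - z) * (2 / Im z ^ 3)) (at z)"
      by (intro tendsto_intros)
    then show "((\<lambda>w. cmod (w - z) * (2 / Im z ^ 3)) \<longlongrightarrow> 0) (at z)" by simp
  qed
qed

lemma holomorphic_F_transform: "F_transform M holomorphic_on upper_half_plane"
  unfolding F_transform_def
  by (intro holomorphic_intros holomorphic_cauchy_transform) (simp add: cauchy_transform_neq_0)

text \<open>The vector \<open>b z\<close> of the overview: \<open>F_transform M z / (z - x)\<close>
  has expectation 1, and subtracting 1 leaves its component orthogonal to the constants.\<close>

definition F_residual :: "complex \<Rightarrow> real \<Rightarrow> complex" where
  "F_residual z x = F_transform M z / (z - complex_of_real x) - 1"

lemma F_residual_measurable [measurable]: "F_residual z \<in> borel_measurable borel"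
  unfolding F_residual_def by measurable

lemma F_residual_bound:
  assumes "0 < Im z" shows "cmod (F_residual z x) \<le> cmod (F_transform M z) / Im z + 1"
proof -
  have "cmod (F_transform M z * (1 / (z - complex_of_real x))) \<le> cmod (F_transform M z) * (1 / Im z)"
    unfolding norm_mult by (intro mult_left_mono norm_resolvent_le assms) auto
  then show ?thesis
    unfolding F_residual_def using norm_triangle_ineq4[of "F_transform M z / (z - complex_of_real x)" 1]
    by simp
qed

lemma integrable_F_residual: "0 < Im z \<Longrightarrow> integrable M (F_residual z)"
  by (rule integrable_const_bound[where B="cmod (F_transform M z) / Im z + 1"])
    (use F_residual_bound in auto)

lemma integrable_F_residual_mult:
  assumes "0 < Im z" "0 < Im w"
  shows "integrable M (\<lambda>x. F_residual z x * F_residual w x)"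
proof (rule integrable_const_bound)
  show "AE x in M. norm (F_residual z x * F_residual w x)
    \<le> (cmod (F_transform M z) / Im z + 1) * (cmod (F_transform M w) / Im w + 1)"
    unfolding norm_mult using assms by (intro AE_I2 mult_mono F_residual_bound) auto
qed measurable

lemma integrable_F_residual_square:
  assumes "0 < Im z" shows "integrable M (\<lambda>x. (cmod (F_residual z x))\<^sup>2)"
  using integrable_norm[OF integrable_F_residual_mult[OF assms assms]]
  by (simp add: norm_mult power2_eq_square)

lemma expectation_F_residual:
  assumes "0 < Im z" shows "expectation (F_residual z) = 0"
proof -
  obtain a where a: "a = (\<lambda>x. 1 / (z - complex_of_real x))" by blast
  have "integrable M a" unfolding a by (rule integrable_resolvent[OF assms])
  then have "expectation (\<lambda>x. F_transform M z * a x - 1) = F_transform M z * expectation a - 1"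
    by (simp add: prob_UNIV)
  also have "\<dots> = 0"
    using cauchy_transform_neq_0[OF assms] by (simp add: F_transform_def cauchy_transform_def a)
  finally show ?thesis unfolding F_residual_def[abs_def] a by simp
qed

text \<open>Expand the product: the resolvent identity turns
  \<open>(z - w) / ((z - x) * (w - x))\<close> into a difference of resolvents, and every remaining
  expectation is a value of the Cauchy transform, that is, a reciprocal of F.\<close>

lemma F_transform_diff:
  assumes z: "0 < Im z" and w: "0 < Im w"
  shows "(F_transform M z - z) - (F_transform M w - w)
    = (z - w) * (\<integral>x. F_residual z x * F_residual w x \<partial>M)"
proof -
  let ?a = "\<lambda>x. 1 / (z - complex_of_real x)" and ?b = "\<lambda>x. 1 / (w - complex_of_real x)"
  let ?F = "F_transform M z" and ?E = "F_transform M w"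
  have ne: "z - complex_of_real x \<noteq> 0" "w - complex_of_real x \<noteq> 0" for x
    using diff_of_real_neq_0 z w by auto
  have "(z - w) * (\<integral>x. F_residual z x * F_residual w x \<partial>M)
    = (\<integral>x. (z - w) * (F_residual z x * F_residual w x) \<partial>M)" by simp
  also have "\<dots> = (\<integral>x. ?F * ?E * (?b x - ?a x) - (z - w) * (?F * ?a x + ?E * ?b x - 1) \<partial>M)"
    using ne by (intro Bochner_Integration.integral_cong refl)
      (simp add: F_residual_def divide_simps, simp add: algebra_simps)
  also have "\<dots> = ?F * ?E * (cauchy_transform M w - cauchy_transform M z)
      - (z - w) * (?F * cauchy_transform M z + ?E * cauchy_transform M w - 1)"
  proof -
    obtain a b F E where ab: "a = ?a" "b = ?b" and FE: "F = ?F" "E = ?E" by blast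
    have "integrable M a" "integrable M b"
      unfolding ab by (rule integrable_resolvent[OF z] integrable_resolvent[OF w])+
    then have "(\<integral>x. F * E * (b x - a x) - (z - w) * (F * a x + E * b x - 1) \<partial>M)
      = F * E * (expectation b - expectation a)
        - (z - w) * (F * expectation a + E * expectation b - 1)"
      by (simp add: prob_UNIV)
    then show ?thesis unfolding cauchy_transform_def ab FE .
  qed
  also have "\<dots> = (?F - z) - (?E - w)"
    using cauchy_transform_neq_0[OF z] cauchy_transform_neq_0[OF w]
    by (simp add: F_transform_def divide_simps) (simp add: algebra_simps)
  finally show ?thesis by simp
qed

text \<open>Formally this is \<open>F_transform_diff\<close> with the conjugate of \<open>z\<close>
  in place of \<open>w\<close>. That point lies in the lower half-plane, so the square is expanded
  directly, with \<open>\<bar>1 / (z - x)\<bar>\<^sup>2\<close> rewritten as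
  \<open>- Im (1 / (z - x)) / Im z\<close>.\<close>

lemma expectation_F_residual_square:
  assumes z: "0 < Im z"
  shows "expectation (\<lambda>x. (cmod (F_residual z x))\<^sup>2) = Im (F_transform M z - z) / Im z"
proof -
  let ?a = "\<lambda>x. 1 / (z - complex_of_real x)"
  let ?G = "cauchy_transform M z" and ?F = "F_transform M z"
  have ne: "z - complex_of_real x \<noteq> 0" for x using diff_of_real_neq_0 z by auto
  obtain a F where a: "a = ?a" and F: "F = ?F" by blast
  have ia: "integrable M a" unfolding a by (rule integrable_resolvent[OF z])
  have *: "(cmod (F_residual z x))\<^sup>2 = - (cmod F)\<^sup>2 / Im z * Im (a x) - 2 * Re (F * a x) + 1" for x
  proof -
    have "(cmod (a x))\<^sup>2 = - Im (a x) / Im z"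
      using z by (simp add: a Im_divide norm_divide cmod_power2 power_divide)
    moreover have "(cmod (F_residual z x))\<^sup>2 = (cmod (F * a x - 1))\<^sup>2"
      by (simp add: F_residual_def a F)
    moreover have "(cmod (F * c - 1))\<^sup>2 = (cmod F)\<^sup>2 * (cmod c)\<^sup>2 - 2 * Re (F * c) + 1" for c
      unfolding cmod_power2 by (simp add: power2_eq_square algebra_simps)
    ultimately show ?thesis by simp
  qed
  have "expectation (\<lambda>x. (cmod (F_residual z x))\<^sup>2)
    = - (cmod F)\<^sup>2 / Im z * Im (expectation a) - 2 * Re (F * expectation a) + 1"
    unfolding *
    using ia integrable_Im[OF ia] integrable_Re[OF integrable_mult_right[OF ia, of F]]
      integral_Re[OF integrable_mult_right[OF ia, of F]] integral_Im[OF ia]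
    by (simp add: prob_UNIV del: times_complex.sel)
  then have "expectation (\<lambda>x. (cmod (F_residual z x))\<^sup>2)
    = - (cmod ?F)\<^sup>2 / Im z * Im ?G - 2 * Re (?F * ?G) + 1"
    by (simp add: a F cauchy_transform_def)
  moreover have FG: "?F * ?G = 1" using cauchy_transform_neq_0[OF z] by (simp add: F_transform_def)
  moreover have "- (cmod ?F)\<^sup>2 * Im ?G = Im ?F"
  proof -
    have "?G = 1 / ?F" by (simp add: F_transform_def)
    then have "Im ?G = - Im ?F / (cmod ?F)\<^sup>2" by (simp add: Im_divide cmod_power2)
    moreover have "?F \<noteq> 0" using FG by auto
    ultimately show ?thesis by simp
  qed
  ultimately show ?thesis using z by (simp add: field_simps)
qed

lemma Im_F_transform_ge:
  assumes z: "0 < Im z" shows "Im z \<le> Im (F_transform M z)"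
proof -
  have "0 \<le> Im (F_transform M z - z) / Im z"
    unfolding expectation_F_residual_square[OF z, symmetric] by simp
  then show ?thesis using z by (simp add: zero_le_divide_iff)
qed

end

subsection \<open>The Poisson formula on the half-plane\<close>

lemma integral_poisson_kernel_1:
  "has_bochner_integral lborel (poisson_kernel 1) 1"
proof -
  have "integrable lborel (\<lambda>x::real. inverse (1 + x\<^sup>2))" "(\<integral>x. inverse (1 + x\<^sup>2) \<partial>lborel) = pi"
    using integrable_inverse_1_plus_square LBINT_inverse_1_plus_square
    by (simp_all add: set_integrable_def interval_lebesgue_integral_def set_lebesgue_integral_def)
  then have "has_bochner_integral lborel (\<lambda>x::real. 1 / pi * inverse (1 + x\<^sup>2)) (1 / pi * pi)"
    by (intro has_bochner_integral_mult_right) (simp add: has_bochner_integral_iff)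
  then show ?thesis by (simp add: poisson_kernel_def[abs_def] field_simps)
qed

lemma poisson_kernel_affine: "0 < y \<Longrightarrow> poisson_kernel y (u - (u + (-y) * v)) = poisson_kernel 1 v / y"
proof -
  assume "0 < y"
  moreover have "(u - (u + (-y) * v))\<^sup>2 + y\<^sup>2 = y\<^sup>2 * (v\<^sup>2 + 1)"
    by (simp add: power2_eq_square algebra_simps)
  ultimately show ?thesis unfolding poisson_kernel_def by (simp add: power2_eq_square)
qed

lemma
  assumes "0 < y"
  shows integrable_poisson_kernel: "integrable lborel (\<lambda>x. poisson_kernel y (u - x))"
    and integral_poisson_kernel: "(\<integral>x. poisson_kernel y (u - x) \<partial>lborel) = 1"
proof -
  have *: "integrable lborel (\<lambda>v. poisson_kernel 1 v / y)" "(\<integral>v. poisson_kernel 1 v / y \<partial>lborel) = 1 / y"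
    using integral_poisson_kernel_1 by (simp_all add: has_bochner_integral_iff)
  have "integrable lborel (\<lambda>v. poisson_kernel y (u - (u + (-y) * v)))"
    unfolding poisson_kernel_affine[OF assms] using * by simp
  then show "integrable lborel (\<lambda>x. poisson_kernel y (u - x))"
    using lborel_integrable_real_affine_iff[of "-y" "\<lambda>x. poisson_kernel y (u - x)" u] assms by simp
  have "(\<integral>x. poisson_kernel y (u - x) \<partial>lborel) = \<bar>- y\<bar> *\<^sub>R (\<integral>v. poisson_kernel y (u - (u + (-y) * v)) \<partial>lborel)"
    by (rule lborel_integral_real_affine) (use assms in simp)
  also have "\<dots> = 1" unfolding poisson_kernel_affine[OF assms] *(2) using assms by simp
  finally show "(\<integral>x. poisson_kernel y (u - x) \<partial>lborel) = 1" .
qed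

text \<open>
  Cauchy's theorem on large half discs, applied to the kernel \<open>1 / (w - z) - 1 / (w - cnj z)\<close>,
  whose quadratic decay removes the arc for every bounded \<open>g\<close>.
\<close>

lemma
  assumes hol: "g holomorphic_on {w. - e < Im w}" and e: "0 < e"
    and bd: "\<And>w. 0 \<le> Im w \<Longrightarrow> cmod (g w) \<le> C" and z: "0 < Im z"
  shows poisson_formula_integrable:
      "integrable lborel (\<lambda>x. poisson_kernel (Im z) (Re z - x) *\<^sub>R g (of_real x))"
    and poisson_formula:
      "(\<integral>x. poisson_kernel (Im z) (Re z - x) *\<^sub>R g (of_real x) \<partial>lborel) = g z"
proof -
  define P where "P x = poisson_kernel (Im z) (Re z - x)" for x
  \<comment> \<open>Cutting at depth \<open>Im z\<close> keeps the pole of \<open>k\<close> at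
    \<open>cnj z\<close> outside \<open>T\<close>, while the closed upper half-plane stays
    inside.\<close>
  define T where "T = {w. - min e (Im z) < Im w}"
  \<comment> \<open>Subtracting \<open>g z\<close> makes the singularity at \<open>z\<close>
    removable, so the closed contour integral is 0 and no residue has to be computed.\<close>
  define q where "q w = (if w = z then deriv g z else (g w - g z) / (w - z))" for w
  define k where "k w = q w / (w - cnj z)" for w
  \<comment> \<open>\<open>P\<close> has total mass 1, so the Poisson formula is equivalent to the
    vanishing of the integral of \<open>h\<close>; on the real line \<open>k\<close> is a constant
    multiple of \<open>h\<close>.\<close>
  define h where "h x = P x *\<^sub>R (g (of_real x) - g z)" for x
  have P: "integrable lborel P" "integral\<^sup>L lborel P = 1" "\<And>x. 0 < P x"
    unfolding P_def using integrable_poisson_kernel integral_poisson_kernel poisson_kernel_pos z by auto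
  have Pm [measurable]: "P \<in> borel_measurable borel" unfolding P_def by measurable
  have C: "0 \<le> C" using order_trans[OF norm_ge_zero bd[of 0]] by simp
  have "continuous_on UNIV (\<lambda>x. g (complex_of_real x))"
    by (rule continuous_on_compose2[OF holomorphic_on_imp_continuous_on[OF hol]])
      (use e in \<open>auto intro!: continuous_intros\<close>)
  then have gm [measurable]: "(\<lambda>x. g (complex_of_real x)) \<in> borel_measurable borel"
    by (rule borel_measurable_continuous_onI)
  show int: "integrable lborel (\<lambda>x. poisson_kernel (Im z) (Re z - x) *\<^sub>R g (of_real x))"
    unfolding P_def[symmetric]
  proof (rule Bochner_Integration.integrable_bound)
    show "integrable lborel (\<lambda>x. P x * C)" using P by simp
    show "AE x in lborel. norm (P x *\<^sub>R g (complex_of_real x)) \<le> norm (P x * C)"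
      using P(3) bd C by (auto simp: abs_mult intro!: mult_left_mono)
  qed measurable
  then have int': "integrable lborel (\<lambda>x. P x *\<^sub>R g (of_real x))" by (simp only: P_def)
  then have hint: "integrable lborel h" unfolding h_def using P by (simp add: scaleR_diff_right)
  have [measurable]: "h \<in> borel_measurable borel" unfolding h_def by measurable
  have "q holomorphic_on {w. - e < Im w}"
    unfolding q_def
    by (rule pole_lemma[OF hol]) (use z e in \<open>simp add: interior_open open_halfspace_Im_gt\<close>)
  then have kT: "k holomorphic_on T"
    unfolding k_def T_def by (intro holomorphic_intros) (auto intro: holomorphic_on_subset simp: complex_eq_iff)
  have kreal: "k (complex_of_real x) = (pi / Im z) *\<^sub>R h x" for x
  proof -
    have "complex_of_real x - z \<noteq> 0" "complex_of_real x - cnj z \<noteq> 0" using z by (auto simp: complex_eq_iff)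
    moreover have "(complex_of_real x - z) * (complex_of_real x - cnj z)
      = of_real ((Re z - x)\<^sup>2 + (Im z)\<^sup>2)"
      by (simp add: complex_eq_iff power2_eq_square algebra_simps)
    moreover have "pi / Im z * P x = 1 / ((Re z - x)\<^sup>2 + (Im z)\<^sup>2)"
      using z by (simp add: P_def poisson_kernel_def)
    ultimately have "1 / ((complex_of_real x - z) * (complex_of_real x - cnj z)) = of_real (pi / Im z * P x)"
      by (metis of_real_1 of_real_divide)
    moreover have "k (complex_of_real x) = (g (of_real x) - g z) * (1 / ((complex_of_real x - z) * (complex_of_real x - cnj z)))"
      using z by (auto simp: k_def q_def)
    ultimately show ?thesis by (simp add: h_def scaleR_conv_of_real)
  qed
  have bound: "cmod (\<integral>x. indicator {-R..R} x *\<^sub>R h x \<partial>lborel)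
      \<le> Im z / pi * (2 * C / (R - cmod z)\<^sup>2 * R * pi)" if R: "cmod z < R" for R
  proof -
    have R0: "0 < R" using R norm_ge_zero[of z] by linarith
    let ?l = "linepath (complex_of_real (-R)) (complex_of_real R)" and ?c = "part_circlepath 0 R 0 pi"
    have imc: "\<exists>t. 0 \<le> t \<and> t \<le> pi \<and> w = of_real R * exp (\<i> * of_real t)" if "w \<in> path_image ?c" for w
      using that by (auto simp: path_image_part_circlepath)
    have imc': "0 \<le> Im w" "cmod w = R" if "w \<in> path_image ?c" for w
      using imc[OF that] R0 by (auto simp: Im_exp norm_mult intro!: mult_nonneg_nonneg sin_ge_zero)
    have cT: "path_image ?c \<subseteq> T" using imc'(1) e z by (force simp: T_def)
    have "path_image ?l \<subseteq> {w. Im w = 0}"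
      by (auto simp: path_image_def linepath_def)
    then have lT: "path_image ?l \<subseteq> T" using e z by (auto simp: T_def)
    have ci: "(k has_contour_integral contour_integral p k) p" if "path_image p \<subseteq> T" "valid_path p" for p
      by (rule has_contour_integral_integral, rule contour_integrable_holomorphic_simple[OF kT _ that(2,1)])
        (simp add: T_def open_halfspace_Im_gt)
    have "(k has_contour_integral (contour_integral ?l k + contour_integral ?c k)) (?l +++ ?c)"
      by (intro has_contour_integral_join ci lT cT) auto
    moreover have "(k has_contour_integral 0) (?l +++ ?c)"
    proof (rule Cauchy_theorem_convex_simple[OF kT])
      show "convex T" by (simp add: T_def convex_halfspace_Im_gt)
      show "path_image (?l +++ ?c) \<subseteq> T" using lT cT by (simp add: path_image_join)
    qed (auto intro!: valid_path_join simp: exp_eq_polar)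
    ultimately have "contour_integral ?l k + contour_integral ?c k = 0"
      using has_contour_integral_unique by blast
    then have "cmod (contour_integral ?l k) = cmod (contour_integral ?c k)"
      by (metis add_eq_0_iff norm_minus_cancel)
    also have "\<dots> \<le> 2 * C / (R - cmod z)\<^sup>2 * R * (pi - 0)"
    proof (rule has_contour_integral_bound_part_circlepath[OF ci[OF cT]])
      fix w assume w: "w \<in> path_image ?c"
      have "R - cmod z \<le> cmod (w - z)" "R - cmod z \<le> cmod (w - cnj z)"
        using norm_triangle_ineq2[of w z] norm_triangle_ineq2[of w "cnj z"] imc'(2)[OF w] by auto
      then have "(R - cmod z)\<^sup>2 \<le> cmod (w - z) * cmod (w - cnj z)"
        using R by (simp add: power2_eq_square mult_mono)
      moreover have "cmod (g w - g z) \<le> 2 * C"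
        using norm_triangle_ineq4[of "g w" "g z"] bd[OF imc'(1)[OF w]] bd[of z] z by linarith
      moreover have "w \<noteq> z" using imc'(2)[OF w] R by auto
      ultimately show "cmod (k w) \<le> 2 * C / (R - cmod z)\<^sup>2"
        using R C by (auto simp: k_def q_def norm_divide norm_mult intro!: frac_le)
    qed (use R0 C in auto)
    finally have 1: "cmod (contour_integral ?l k) \<le> 2 * C / (R - cmod z)\<^sup>2 * R * pi" by simp
    have "contour_integral ?l k = integral {-R..R} (\<lambda>x. k (of_real x))"
      using contour_integral_linepath_Reals_eq[of "of_real (-R)" "of_real R" k] R0 by simp
    also have "\<dots> = (LINT x:{-R..R}|lborel. k (of_real x))"
      unfolding kreal
      by (rule set_borel_integral_eq_integral(2)[symmetric], unfold set_integrable_def,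
          intro integrable_mult_indicator integrable_scaleR_right hint) auto
    also have "\<dots> = (pi / Im z) *\<^sub>R (\<integral>x. indicator {-R..R} x *\<^sub>R h x \<partial>lborel)"
      unfolding kreal set_lebesgue_integral_def
      by (subst integral_scaleR_right[symmetric]) (auto simp: mult_ac)
    finally have "cmod (\<integral>x. indicator {-R..R} x *\<^sub>R h x \<partial>lborel) = Im z / pi * cmod (contour_integral ?l k)"
      using z by simp
    also have "\<dots> \<le> Im z / pi * (2 * C / (R - cmod z)\<^sup>2 * R * pi)"
      using 1 z by (intro mult_left_mono) auto
    finally show ?thesis .
  qed
  have "((\<lambda>R. \<integral>x. indicator {-R..R} x *\<^sub>R h x \<partial>lborel) \<longlongrightarrow> integral\<^sup>L lborel h) at_top"
  proof (rule integral_dominated_convergence_at_top)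
    show "integrable lborel (\<lambda>x. norm (h x))" using hint by simp
    show "AE x in lborel. ((\<lambda>R. indicator {-R..R} x *\<^sub>R h x) \<longlongrightarrow> h x) at_top"
    proof (rule AE_I2)
      fix x
      have "\<forall>\<^sub>F R in at_top. indicator {-R..R} x *\<^sub>R h x = h x"
        using eventually_ge_at_top[of "\<bar>x\<bar>"] by eventually_elim (auto simp: indicator_def)
      then show "((\<lambda>R. indicator {-R..R} x *\<^sub>R h x) \<longlongrightarrow> h x) at_top" by (rule tendsto_eventually)
    qed
  qed (auto simp: indicator_def)
  moreover have "((\<lambda>R. \<integral>x. indicator {-R..R} x *\<^sub>R h x \<partial>lborel) \<longlongrightarrow> 0) at_top"
  proof (rule Lim_null_comparison)
    show "\<forall>\<^sub>F R in at_top. norm (\<integral>x. indicator {-R..R} x *\<^sub>R h x \<partial>lborel)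
        \<le> Im z / pi * (2 * C / (R - cmod z)\<^sup>2 * R * pi)"
      using eventually_gt_at_top[of "cmod z"] by eventually_elim (rule bound)
    show "((\<lambda>R. Im z / pi * (2 * C / (R - cmod z)\<^sup>2 * R * pi)) \<longlongrightarrow> 0) at_top"
      by real_asymp
  qed
  ultimately have "integral\<^sup>L lborel h = 0"
    by (rule tendsto_unique[rotated]) simp
  then show "(\<integral>x. poisson_kernel (Im z) (Re z - x) *\<^sub>R g (of_real x) \<partial>lborel) = g z"
    unfolding h_def P_def[symmetric] using int' P by (simp add: scaleR_diff_right)
qed

subsection \<open>Existence of a measure with a given F-transform\<close>

lemma poisson_kernel_le: "0 < y \<Longrightarrow> poisson_kernel y u \<le> 1 / (pi * y)"
proof -
  assume y: "0 < y"
  then have "y / (pi * (u\<^sup>2 + y\<^sup>2)) \<le> y / (pi * y\<^sup>2)"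
    by (intro divide_left_mono mult_left_mono mult_pos_pos add_nonneg_pos) auto
  then show ?thesis using y by (simp add: poisson_kernel_def power2_eq_square)
qed

lemma isCont_poisson_kernel: "0 < y \<Longrightarrow> isCont (\<lambda>x. poisson_kernel y (u - x)) x"
  unfolding poisson_kernel_def by (intro continuous_intros) (auto simp: add_nonneg_eq_0_iff)

text \<open>
  The measure has density \<open>- Im g / pi\<close> on the real line; its total mass is read off from
  \<open>- y * Im (g (\<i> y)) = \<integral> y\<^sup>2 / (x\<^sup>2 + y\<^sup>2)\<close> by monotone convergence.
\<close>

lemma poisson_representation:
  assumes hol: "g holomorphic_on {w. - e < Im w}" and e: "0 < e"
    and bd: "\<And>w. 0 \<le> Im w \<Longrightarrow> cmod (g w) \<le> C"
    and neg: "\<And>w. 0 \<le> Im w \<Longrightarrow> Im (g w) \<le> 0"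
    and lim: "((\<lambda>y. - y * Im (g (\<i> * of_real y))) \<longlongrightarrow> 1) at_top"
  obtains N where "real_distribution N"
    "\<And>z. 0 < Im z \<Longrightarrow> (\<integral>x. poisson_kernel (Im z) (Re z - x) \<partial>N) = - Im (g z) / pi"
proof
  define p where "p x = - Im (g (of_real x)) / pi" for x
  have p0: "0 \<le> p x" for x using neg[of "of_real x"] by (simp add: p_def divide_le_0_iff)
  have "continuous_on UNIV (\<lambda>x. g (complex_of_real x))"
    by (rule continuous_on_compose2[OF holomorphic_on_imp_continuous_on[OF hol]])
      (use e in \<open>auto intro!: continuous_intros\<close>)
  then have [measurable]: "(\<lambda>x. g (complex_of_real x)) \<in> borel_measurable borel"
    by (rule borel_measurable_continuous_onI)
  have pm [measurable]: "p \<in> borel_measurable borel" unfolding p_def by measurable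
  have rep: "integrable lborel (\<lambda>x. p x * poisson_kernel (Im z) (Re z - x))"
    "(\<integral>x. p x * poisson_kernel (Im z) (Re z - x) \<partial>lborel) = - Im (g z) / pi" if "0 < Im z" for z
  proof -
    note i = poisson_formula_integrable[OF hol e bd that]
    have eq: "p x * poisson_kernel (Im z) (Re z - x)
      = - Im (poisson_kernel (Im z) (Re z - x) *\<^sub>R g (of_real x)) / pi" for x
      by (simp add: p_def)
    show "integrable lborel (\<lambda>x. p x * poisson_kernel (Im z) (Re z - x))"
      unfolding eq using integrable_Im[OF i] by simp
    show "(\<integral>x. p x * poisson_kernel (Im z) (Re z - x) \<partial>lborel) = - Im (g z) / pi"
      unfolding eq using integral_Im[OF i] poisson_formula[OF hol e bd that] by simp
  qed
  define f where "f n x = pi * real (Suc n) * (p x * poisson_kernel (real (Suc n)) (0 - x))" for n x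
  have f_eq: "f n x = p x * ((real (Suc n))\<^sup>2 / (x\<^sup>2 + (real (Suc n))\<^sup>2))" for n x
    by (simp add: f_def poisson_kernel_def power2_eq_square)
  have fi: "integrable lborel (f n)" "integral\<^sup>L lborel (f n) = - real (Suc n) * Im (g (\<i> * of_real (real (Suc n))))" for n
    unfolding f_def using rep[of "\<i> * of_real (real (Suc n))"] by (simp_all add: algebra_simps)
  have mono: "mono (\<lambda>n. f n x)" for x
  proof (rule monoI)
    fix m n :: nat assume "m \<le> n"
    have "s / (x\<^sup>2 + s) \<le> t / (x\<^sup>2 + t)" if "0 < s" "s \<le> t" for s t :: real
      using that by (simp add: divide_simps add_nonneg_pos add_nonneg_eq_0_iff)
        (simp add: algebra_simps mult_right_mono)
    then show "f m x \<le> f n x"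
      unfolding f_eq using \<open>m \<le> n\<close> p0 by (intro mult_left_mono) (auto intro!: power_mono)
  qed
  have "(\<lambda>n. - real (Suc n) * Im (g (\<i> * of_real (real (Suc n))))) \<longlonglongrightarrow> 1"
    by (rule filterlim_compose[OF lim]) real_asymp
  then have ilim: "(\<lambda>n. integral\<^sup>L lborel (f n)) \<longlonglongrightarrow> 1" unfolding fi(2) .
  have flim: "(\<lambda>n. f n x) \<longlonglongrightarrow> p x" for x
  proof -
    have "(\<lambda>n. (real (Suc n))\<^sup>2 / (x\<^sup>2 + (real (Suc n))\<^sup>2)) \<longlonglongrightarrow> 1" by real_asymp
    then have "(\<lambda>n. f n x) \<longlonglongrightarrow> p x * 1" unfolding f_eq by (intro tendsto_intros)
    then show ?thesis by simp
  qed
  have fpos: "0 \<le> f n x" for n x unfolding f_eq using p0 by simp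
  have p1: "integrable lborel p" "integral\<^sup>L lborel p = 1"
    by (rule integral_monotone_convergence_nonneg[OF fi(1) _ _ _ ilim]; use mono fpos flim in auto)+
  show "real_distribution (density lborel p)"
  proof (intro real_distribution.intro real_distribution_axioms.intro prob_spaceI)
    have "(\<integral>\<^sup>+x. ennreal (p x) \<partial>lborel) = 1"
      using p1 p0 by (simp add: nn_integral_eq_integral)
    then show "emeasure (density lborel p) (space (density lborel p)) = 1"
      by (simp add: emeasure_density)
  qed simp
  fix z :: complex assume z: "0 < Im z"
  show "(\<integral>x. poisson_kernel (Im z) (Re z - x) \<partial>density lborel p) = - Im (g z) / pi"
    using p0 rep(2)[OF z] by (subst integral_density) auto
qed

text \<open>\<open>pi * y\<close> times the kernel is
  \<open>y\<^sup>2 / (x\<^sup>2 + y\<^sup>2)\<close>, which is at most 1 on \<open>{-y<..y}\<close>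
  and at most 1/2 outside. If its mean exceeds \<open>1 - \<epsilon> / 2\<close>, the interval has
  probability above \<open>1 - \<epsilon>\<close>; hence the halved tolerance below.\<close>

lemma tight_poissonI:
  assumes "\<And>n. real_distribution (N n)"
    and lim: "\<And>\<delta>. 0 < \<delta> \<Longrightarrow> \<exists>y>0. \<forall>n. 1 - \<delta> < pi * y * (\<integral>x. poisson_kernel y (- x) \<partial>N n)"
  shows "tight N"
  unfolding tight_def
proof (intro conjI allI impI)
  fix n show "real_distribution (N n)" by fact
next
  fix \<epsilon> :: real assume "0 < \<epsilon>"
  then obtain y where y: "0 < y" and *: "\<And>n. 1 - \<epsilon> / 2 < pi * y * (\<integral>x. poisson_kernel y (- x) \<partial>N n)"
    using lim[of "\<epsilon> / 2"] by auto
  show "\<exists>a b. a < b \<and> (\<forall>n. 1 - \<epsilon> < measure (N n) {a<..b})"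
  proof (intro exI conjI allI)
    show "- y < y" using y by simp
    fix n
    interpret real_distribution "N n" by fact
    have ind: "integrable (N n) (indicat_real {-y<..y})"
      by (intro integrable_real_indicator) (auto simp: less_top[symmetric])
    have "pi * y * (\<integral>x. poisson_kernel y (- x) \<partial>N n) = (\<integral>x. pi * y * poisson_kernel y (- x) \<partial>N n)"
      by simp
    also have "\<dots> \<le> (\<integral>x. 1 / 2 + 1 / 2 * indicat_real {-y<..y} x \<partial>N n)"
    proof (rule integral_mono)
      show "integrable (N n) (\<lambda>x. pi * y * poisson_kernel y (- x))"
        using Im_cauchy_transform(2)[of "\<i> * of_real y"] y by simp
      show "integrable (N n) (\<lambda>x. 1 / 2 + 1 / 2 * indicat_real {-y<..y} x)" using ind by simp
      fix x
      have "pi * y * poisson_kernel y (- x) = y\<^sup>2 / (x\<^sup>2 + y\<^sup>2)"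
        by (simp add: poisson_kernel_def power2_eq_square)
      also have "\<dots> \<le> 1 / 2 + 1 / 2 * indicat_real {-y<..y} x"
      proof (cases "x \<in> {-y<..y}")
        case True
        have "0 < x\<^sup>2 + y\<^sup>2" using y by (intro add_nonneg_pos) auto
        then show ?thesis using True by (simp add: divide_simps)
      next
        case False
        then have "y\<^sup>2 \<le> x\<^sup>2" using y by (intro abs_le_square_iff[THEN iffD1]) auto
        then show ?thesis using False y by (simp add: divide_simps add_nonneg_pos)
      qed
      finally show "pi * y * poisson_kernel y (- x) \<le> 1 / 2 + 1 / 2 * indicat_real {-y<..y} x" .
    qed
    also have "\<dots> = 1 / 2 + 1 / 2 * prob {-y<..y}" using ind by (simp add: prob_UNIV)
    finally show "1 - \<epsilon> < prob {-y<..y}" using *[of n] by simp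
  qed
qed

text \<open>By the open mapping theorem a nonconstant \<open>f\<close> would have an open image, but
  the real line has empty interior in the plane.\<close>

lemma holomorphic_real_valued_constant:
  assumes "f holomorphic_on S" "open S" "connected S" and "\<And>z. z \<in> S \<Longrightarrow> Im (f z) = 0"
  shows "f constant_on S"
proof (rule ccontr)
  assume "\<not> f constant_on S"
  then have "open (f ` S)"
    using open_mapping_thm[OF assms(1-3) assms(2) order_refl] by simp
  moreover have "f ` S \<subseteq> {z. Im z = 0}" using assms(4) by auto
  ultimately have "f ` S \<subseteq> interior {z. Im z = 0}" by (simp add: interior_maximal)
  moreover have "interior {z. Im z = 0} = {}"
    using interior_hyperplane[of "\<i>" 0] by (simp add: inner_complex_def)
  ultimately have "S = {}" by simp
  with \<open>\<not> f constant_on S\<close> show False by (simp add: constant_on_def)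
qed

text \<open>\<open>1 / F\<close> need not extend to the real line, so it is shifted by
  \<open>\<i> * e n\<close>, which makes the Poisson representation applicable, and the shift is
  sent to 0. The hypothesis at infinity prevents loss of mass. Weak limits recover only the
  imaginary part of \<open>1 / F\<close>; the additive constant left open is removed by the decay of
  order \<open>1 / y\<close> along the imaginary axis.\<close>

theorem F_transform_exists:
  assumes hol: "F holomorphic_on upper_half_plane"
    and im: "\<And>z. 0 < Im z \<Longrightarrow> Im z \<le> Im (F z)"
    and lim: "((\<lambda>y. F (\<i> * of_real y) / (\<i> * of_real y)) \<longlongrightarrow> 1) at_top"
  obtains N where "real_distribution N" "\<And>z. 0 < Im z \<Longrightarrow> F_transform N z = F z"
proof -
  define G where "G z = 1 / F z" for z
  have F0: "F z \<noteq> 0" if "0 < Im z" for z using im[OF that] that by auto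
  have hG: "G holomorphic_on upper_half_plane"
    unfolding G_def by (intro holomorphic_intros hol) (simp add: F0)
  have bG: "cmod (G z) \<le> 1 / Im z" if "0 < Im z" for z
    using order_trans[OF im[OF that] order_trans[OF abs_ge_self abs_Im_le_cmod]] that
    by (auto simp: G_def norm_divide intro!: frac_le)
  have nG: "Im (G z) \<le> 0" if "0 < Im z" for z
    using im[OF that] that by (auto simp: G_def Im_divide divide_le_0_iff)
  define \<phi> where "\<phi> v = - v * Im (G (\<i> * of_real v))" for v
  have \<phi>lim: "(\<phi> \<longlongrightarrow> 1) at_top"
  proof -
    have "((\<lambda>y. Re (inverse (F (\<i> * of_real y) / (\<i> * of_real y)))) \<longlongrightarrow> Re (inverse 1)) at_top"
      by (intro tendsto_intros lim) auto
    moreover have "Re (inverse (F (\<i> * of_real y) / (\<i> * of_real y))) = \<phi> y" for y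
    proof -
      have "inverse (F (\<i> * of_real y) / (\<i> * of_real y)) = \<i> * of_real y * G (\<i> * of_real y)"
        by (simp add: G_def)
      then show ?thesis by (simp add: \<phi>_def)
    qed
    ultimately show ?thesis by simp
  qed
  define e where "e n = 1 / real (Suc n)" for n
  have e: "0 < e n" "e n \<le> 1" for n by (auto simp: e_def)
  define g where "g n z = G (z + \<i> * of_real (e n))" for n z
  have "\<exists>N. real_distribution N \<and> (\<forall>z. 0 < Im z \<longrightarrow> (\<integral>x. poisson_kernel (Im z) (Re z - x) \<partial>N) = - Im (g n z) / pi)" for n
  proof (rule poisson_representation[of "g n" "e n" "1 / e n"])
    show "g n holomorphic_on {w. - e n < Im w}"
      unfolding g_def
      by (rule holomorphic_on_compose_gen[OF _ hG, unfolded o_def]) (auto intro!: holomorphic_intros)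
    show "cmod (g n w) \<le> 1 / e n" if "0 \<le> Im w" for w
      unfolding g_def using that e[of n] by (intro order_trans[OF bG]) (auto intro!: frac_le)
    show "Im (g n w) \<le> 0" if "0 \<le> Im w" for w
      unfolding g_def using that e[of n] by (intro nG) auto
    have "((\<lambda>y. y / (y + e n) * \<phi> (y + e n)) \<longlongrightarrow> 1 * 1) at_top"
    proof (intro tendsto_mult)
      show "((\<lambda>y. y / (y + e n)) \<longlongrightarrow> 1) at_top" by real_asymp
      show "((\<lambda>y. \<phi> (y + e n)) \<longlongrightarrow> 1) at_top"
        by (rule filterlim_compose[OF \<phi>lim]) real_asymp
    qed
    moreover have "\<forall>\<^sub>F y in at_top. y / (y + e n) * \<phi> (y + e n) = - y * Im (g n (\<i> * of_real y))"
      using eventually_gt_at_top[of 0]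
      by eventually_elim (use e[of n] in \<open>simp add: \<phi>_def g_def field_simps\<close>)
    ultimately show "((\<lambda>y. - y * Im (g n (\<i> * of_real y))) \<longlongrightarrow> 1) at_top"
      using tendsto_cong by force
  qed (use e in auto)
  then obtain N where Nd: "\<And>n. real_distribution (N n)"
    and Ni: "\<And>n z. 0 < Im z \<Longrightarrow> (\<integral>x. poisson_kernel (Im z) (Re z - x) \<partial>N n) = - Im (g n z) / pi"
    by metis
  have "tight N"
  proof (rule tight_poissonI[OF Nd])
    fix \<delta>' :: real assume "0 < \<delta>'"
    \<comment> \<open>\<open>2 * \<delta> < \<delta>'\<close> gives
      \<open>(1 - \<delta>)\<^sup>2 > 1 - \<delta>'\<close>: one factor pays for
      \<open>\<phi>\<close> not yet being 1, the other for the vertical shift, which is at most 1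
      and hence relatively small once \<open>y \<ge> 1 / \<delta>\<close>.\<close>
    define \<delta> where "\<delta> = min (1 / 2) (\<delta>' / 3)"
    have \<delta>: "0 < \<delta>" "\<delta> < 1" "2 * \<delta> < \<delta>'" using \<open>0 < \<delta>'\<close> by (auto simp: \<delta>_def)
    have "\<forall>\<^sub>F v in at_top. 1 - \<delta> < \<phi> v" using \<phi>lim \<delta> by (intro order_tendstoD(1)) auto
    then obtain Y where Y: "\<And>v. Y \<le> v \<Longrightarrow> 1 - \<delta> < \<phi> v" unfolding eventually_at_top_linorder by blast
    define y where "y = max Y (1 / \<delta>)"
    have y: "0 < y" "Y \<le> y" "1 / \<delta> \<le> y" using \<delta> by (auto simp: y_def less_max_iff_disj)
    show "\<exists>y>0. \<forall>n. 1 - \<delta>' < pi * y * (\<integral>x. poisson_kernel y (- x) \<partial>N n)"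
    proof (intro exI conjI allI)
      fix n
      have "1 \<le> \<delta> * y" using y(3) \<delta> by (simp add: field_simps)
      then have "(1 - \<delta>) * (y + e n) \<le> y"
        using e(1,2)[of n] \<delta> mult_left_mono[of "e n" 1 "1 - \<delta>"] by (simp add: algebra_simps)
      then have "1 - \<delta> \<le> y / (y + e n)" using y e[of n] by (simp add: field_simps)
      moreover have "1 - \<delta> < \<phi> (y + e n)" using Y y(2) e(1)[of n] by simp
      ultimately have "(1 - \<delta>) * (1 - \<delta>) \<le> y / (y + e n) * \<phi> (y + e n)"
        using \<delta> y e[of n] by (intro mult_mono) auto
      moreover have "1 - \<delta>' < (1 - \<delta>) * (1 - \<delta>)"
      proof -
        have "(1 - \<delta>) * (1 - \<delta>) = 1 - 2 * \<delta> + \<delta> * \<delta>" by (simp add: algebra_simps)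
        then show ?thesis using \<delta> mult_pos_pos[OF \<delta>(1) \<delta>(1)] by linarith
      qed
      moreover have "pi * y * (\<integral>x. poisson_kernel y (- x) \<partial>N n) = y / (y + e n) * \<phi> (y + e n)"
      proof -
        have "y / (y + e n) * \<phi> (y + e n) = - y * Im (g n (\<i> * of_real y))"
        proof -
          have "y / a * (- a * b) = - y * b" if "a \<noteq> 0" for a b :: real using that by simp
          moreover have "y + e n \<noteq> 0" using y e(1)[of n] by simp
          ultimately show ?thesis unfolding \<phi>_def g_def by (simp only: of_real_add distrib_left)
        qed
        then show ?thesis using Ni[of "\<i> * of_real y" n] y by simp
      qed
      ultimately show "1 - \<delta>' < pi * y * (\<integral>x. poisson_kernel y (- x) \<partial>N n)" by linarith
    qed (rule y)
  qed
  then obtain r M where r: "strict_mono (r :: nat \<Rightarrow> nat)" and M: "real_distribution M"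
    and conv: "weak_conv_m (N \<circ> id \<circ> r) M"
    using tight_imp_convergent_subsubsequence[of N id] strict_mono_id by blast
  interpret M: real_distribution M by fact
  have Im_eq: "Im (cauchy_transform M z) = Im (G z)" if z: "0 < Im z" for z
  proof -
    have "(\<lambda>n. \<integral>x. poisson_kernel (Im z) (Re z - x) \<partial>(N \<circ> id \<circ> r) n)
        \<longlonglongrightarrow> (\<integral>x. poisson_kernel (Im z) (Re z - x) \<partial>M)"
    proof (rule weak_conv_imp_integral_bdd_continuous_conv[OF _ M conv])
      show "norm (poisson_kernel (Im z) (Re z - x)) \<le> 1 / (pi * Im z)" for x
        using poisson_kernel_pos[OF z, of "Re z - x"] poisson_kernel_le[OF z] by simp
    qed (use Nd isCont_poisson_kernel[OF z] in auto)
    then have "(\<lambda>n. - Im (g (r n) z) / pi) \<longlonglongrightarrow> (\<integral>x. poisson_kernel (Im z) (Re z - x) \<partial>M)"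
      using Ni[OF z] by simp
    moreover have "(\<lambda>n. - Im (g (r n) z) / pi) \<longlonglongrightarrow> - Im (G z) / pi"
    proof -
      have "(\<lambda>n. g n z) \<longlonglongrightarrow> G z"
        unfolding g_def
      proof (rule continuous_on_tendsto_compose[OF holomorphic_on_imp_continuous_on[OF hG]])
        have "e \<longlonglongrightarrow> 0" unfolding e_def by real_asymp
        then have "(\<lambda>n. z + \<i> * complex_of_real (e n)) \<longlonglongrightarrow> z + \<i> * complex_of_real 0"
          by (intro tendsto_intros)
        then show "(\<lambda>n. z + \<i> * complex_of_real (e n)) \<longlonglongrightarrow> z" by simp
        show "\<forall>\<^sub>F n in sequentially. z + \<i> * complex_of_real (e n) \<in> upper_half_plane"
          using z e by (auto intro!: always_eventually add_pos_pos)
      qed (use z in simp)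
      then have "(\<lambda>n. g (r n) z) \<longlonglongrightarrow> G z" using LIMSEQ_subseq_LIMSEQ[OF _ r] by (simp add: o_def)
      then show ?thesis by (intro tendsto_intros) auto
    qed
    ultimately have "(\<integral>x. poisson_kernel (Im z) (Re z - x) \<partial>M) = - Im (G z) / pi"
      by (rule LIMSEQ_unique)
    then show ?thesis using M.Im_cauchy_transform(1)[OF z] by simp
  qed
  have "(\<lambda>z. cauchy_transform M z - G z) constant_on upper_half_plane"
    by (rule holomorphic_real_valued_constant[OF _ open_upper_half_plane connected_upper_half_plane])
      (auto intro!: holomorphic_intros hG M.holomorphic_cauchy_transform simp: Im_eq)
  then obtain c where c: "\<And>z. 0 < Im z \<Longrightarrow> cauchy_transform M z - G z = c"
    unfolding constant_on_def by auto
  have "((\<lambda>y::real. c) \<longlongrightarrow> 0) at_top"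
  proof (rule Lim_null_comparison)
    show "\<forall>\<^sub>F y in at_top. cmod c \<le> 2 / y"
      using eventually_gt_at_top[of 0]
    proof eventually_elim
      fix y :: real assume y: "0 < y"
      show "cmod c \<le> 2 / y"
        using c[of "\<i> * of_real y"] norm_triangle_ineq4[of "cauchy_transform M (\<i> * of_real y)" "G (\<i> * of_real y)"]
          M.norm_cauchy_transform_le[of "\<i> * of_real y"] bG[of "\<i> * of_real y"] y by simp
    qed
    show "((\<lambda>y::real. 2 / y) \<longlongrightarrow> 0) at_top" by real_asymp
  qed
  then have "c = 0" by (simp add: tendsto_const_iff)
  then have "F_transform M z = F z" if "0 < Im z" for z
    using c[OF that] by (simp add: F_transform_def G_def)
  with M show ?thesis by (rule that)
qed

subsection \<open>Weak convergence from Cauchy transforms\<close>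

lemma standard_cauchy_distribution_eq:
  "standard_cauchy_distribution = density lborel (poisson_kernel 1)"
  by (simp add: standard_cauchy_distribution_def poisson_kernel_def)

lemma real_distribution_standard_cauchy: "real_distribution standard_cauchy_distribution"
proof (intro real_distribution.intro real_distribution_axioms.intro prob_spaceI)
  have "(\<integral>\<^sup>+x. ennreal (poisson_kernel 1 x) \<partial>lborel) = 1"
    using integral_poisson_kernel_1 poisson_kernel_pos[of 1]
    by (subst nn_integral_eq_integral) (auto simp: has_bochner_integral_iff less_imp_le)
  then show "emeasure standard_cauchy_distribution (space standard_cauchy_distribution) = 1"
    by (simp add: standard_cauchy_distribution_eq emeasure_density)
qed (simp add: standard_cauchy_distribution_eq)

lemma char_standard_cauchy:
  "char standard_cauchy_distribution t = (\<integral>x. poisson_kernel 1 x *\<^sub>R iexp (t * x) \<partial>lborel)"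
  unfolding char_def standard_cauchy_distribution_eq
  using poisson_kernel_pos[of 1] by (intro integral_density) (auto simp: less_imp_le)

text \<open>Apply the Poisson formula to \<open>1 / (w + \<i>)\<close>, whose pole lies below the
  real line and whose imaginary part on the line is \<open>- pi\<close> times the Cauchy density. In
  terms of kernels: scales 1 and \<open>y\<close> convolve to scale \<open>1 + y\<close>.\<close>

lemma Im_cauchy_transform_standard_cauchy:
  assumes z: "0 < Im z"
  shows "Im (cauchy_transform standard_cauchy_distribution z) = Im (1 / (z + \<i>))"
proof -
  interpret real_distribution standard_cauchy_distribution by (rule real_distribution_standard_cauchy)
  let ?g = "\<lambda>w. 1 / (w + \<i>)"
  have ne: "w + \<i> \<noteq> 0" if "-1 < Im w" for w using that by (auto simp: complex_eq_iff)
  have hol: "?g holomorphic_on {w. - 1 < Im w}"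
    using ne by (intro holomorphic_intros) auto
  have bd: "cmod (?g w) \<le> 1" if "0 \<le> Im w" for w
    using abs_Im_le_cmod[of "w + \<i>"] that by (simp add: norm_divide divide_simps)
  have Im_g: "Im (?g (of_real x)) = - pi * poisson_kernel 1 x" for x
    by (simp add: poisson_kernel_def Im_divide power2_eq_square)
  have "(\<integral>x. poisson_kernel (Im z) (Re z - x) \<partial>standard_cauchy_distribution)
    = (\<integral>x. poisson_kernel 1 x * poisson_kernel (Im z) (Re z - x) \<partial>lborel)"
    unfolding standard_cauchy_distribution_eq
    using poisson_kernel_pos[of 1] by (subst integral_density) (auto simp: less_imp_le)
  then have "- pi * (\<integral>x. poisson_kernel (Im z) (Re z - x) \<partial>standard_cauchy_distribution)
    = (\<integral>x. - pi * (poisson_kernel 1 x * poisson_kernel (Im z) (Re z - x)) \<partial>lborel)"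
    by (simp only: integral_mult_right_zero)
  also have "\<dots> = (\<integral>x. Im (poisson_kernel (Im z) (Re z - x) *\<^sub>R ?g (of_real x)) \<partial>lborel)"
    by (intro Bochner_Integration.integral_cong refl) (use Im_g in simp)
  also have "\<dots> = Im (?g z)"
    using integral_Im[OF poisson_formula_integrable[OF hol _ bd z]] poisson_formula[OF hol _ bd z] by simp
  finally show ?thesis using Im_cauchy_transform(1)[OF z] by simp
qed

section \<open>Smoothing by Cauchy laws\<close>

context real_distribution
begin

text \<open>The density of the convolution of \<open>M\<close> with the Cauchy law of scale
  \<open>y\<close>.\<close>

definition poisson_smoothing :: "real \<Rightarrow> real \<Rightarrow> real" where
  "poisson_smoothing y u = (\<integral>x. poisson_kernel y (u - x) \<partial>M)"

lemma poisson_smoothing_eq: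
  "0 < y \<Longrightarrow> poisson_smoothing y u = - Im (cauchy_transform M (Complex u y)) / pi"
  using Im_cauchy_transform(1)[of "Complex u y"] by (simp add: poisson_smoothing_def)

lemma poisson_smoothing_nonneg: "0 < y \<Longrightarrow> 0 \<le> poisson_smoothing y u"
  unfolding poisson_smoothing_def using poisson_kernel_pos[of y]
  by (intro integral_nonneg_AE) (auto simp: less_imp_le)

lemma pair_sigma_finite_lborel: "pair_sigma_finite M lborel"
  by (intro pair_sigma_finite.intro lborel.sigma_finite_measure_axioms sigma_finite_measure_axioms)

lemma poisson_kernel_commute: "0 < y \<Longrightarrow> poisson_kernel y (x - u) = poisson_kernel y (u - x)"
  by (simp add: poisson_kernel_def power2_commute)

lemma integrable_pair_poisson_kernel:
  assumes y: "0 < y"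
  shows "integrable (M \<Otimes>\<^sub>M lborel) (\<lambda>(x, u). poisson_kernel y (u - x) *\<^sub>R iexp (t * u))"
proof -
  interpret pair_sigma_finite M lborel by (rule pair_sigma_finite_lborel)
  have i: "integrable lborel (\<lambda>u. poisson_kernel y (u - x))" "(\<integral>u. poisson_kernel y (u - x) \<partial>lborel) = 1" for x
    using integrable_poisson_kernel[OF y, of x] integral_poisson_kernel[OF y, of x]
    by (simp_all add: poisson_kernel_commute[OF y])
  show ?thesis
  proof (rule Fubini_integrable)
    show "integrable M (\<lambda>x. \<integral>u. norm ((case (x, u) of (x, u) \<Rightarrow> poisson_kernel y (u - x) *\<^sub>R iexp (t * u))) \<partial>lborel)"
      using poisson_kernel_pos[OF y] i(2) by (simp add: less_imp_le)
    show "AE x in M. integrable lborel (\<lambda>u. (case (x, u) of (x, u) \<Rightarrow> poisson_kernel y (u - x) *\<^sub>R iexp (t * u)))"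
    proof (rule AE_I2)
      fix x
      show "integrable lborel (\<lambda>u. (case (x, u) of (x, u) \<Rightarrow> poisson_kernel y (u - x) *\<^sub>R iexp (t * u)))"
        by (rule Bochner_Integration.integrable_bound[OF i(1)[of x]]) auto
    qed
  qed measurable
qed

text \<open>Fubini, with the substitution \<open>u = x + y * v\<close> in the inner integral, splits
  off the factor \<open>iexp (t * x)\<close>. The characteristic function of the Cauchy law is left
  unevaluated: later steps use only its continuity and its value at 0.\<close>

lemma
  assumes y: "0 < y"
  shows integrable_poisson_smoothing: "integrable lborel (poisson_smoothing y)"
    and fourier_poisson_smoothing:
      "(\<integral>u. poisson_smoothing y u *\<^sub>R iexp (t * u) \<partial>lborel)
        = char M t * char standard_cauchy_distribution (t * y)"
proof -
  interpret pair_sigma_finite M lborel by (rule pair_sigma_finite_lborel)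
  let ?f = "\<lambda>t x u. poisson_kernel y (u - x) *\<^sub>R iexp (t * u)"
  have int: "integrable (M \<Otimes>\<^sub>M lborel) (\<lambda>(x, u). ?f t x u)" for t
    by (rule integrable_pair_poisson_kernel[OF y])
  have pint: "integrable M (\<lambda>x. poisson_kernel y (u - x))" for u
    using Im_cauchy_transform(2)[of "Complex u y"] y by simp
  have sm: "(\<integral>x. ?f t x u \<partial>M) = poisson_smoothing y u *\<^sub>R iexp (t * u)" for t u
    unfolding poisson_smoothing_def using pint by (intro integral_scaleR_left) auto
  have "integrable lborel (\<lambda>u. \<integral>x. ?f 0 x u \<partial>M)" by (rule integrable_snd[OF int])
  then have "integrable lborel (\<lambda>u. complex_of_real (poisson_smoothing y u))"
    unfolding sm by (simp add: scaleR_conv_of_real)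
  then show "integrable lborel (poisson_smoothing y)" by (simp only: complex_of_real_integrable_eq)
  have inner: "(\<integral>u. ?f t x u \<partial>lborel) = iexp (t * x) * char standard_cauchy_distribution (t * y)" for x
  proof -
    have "(\<integral>u. ?f t x u \<partial>lborel) = \<bar>y\<bar> *\<^sub>R (\<integral>v. ?f t x (x + y * v) \<partial>lborel)"
      by (rule lborel_integral_real_affine) (use y in simp)
    also have "\<dots> = (\<integral>v. of_real y * ?f t x (x + y * v) \<partial>lborel)"
      using y by (simp only: abs_of_pos scaleR_conv_of_real[of y] integral_mult_right_zero)
    also have "\<dots> = (\<integral>v. iexp (t * x) * (poisson_kernel 1 v *\<^sub>R iexp (t * y * v)) \<partial>lborel)"
    proof (intro Bochner_Integration.integral_cong refl)
      fix v
      have "y * poisson_kernel y (x + y * v - x) = poisson_kernel 1 v"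
        using y poisson_kernel_affine[OF y, of x v] poisson_kernel_commute[OF y, of "y * v" 0]
        by (simp add: poisson_kernel_def power_mult_distrib)
      moreover have "iexp (t * (x + y * v)) = iexp (t * x) * iexp (t * y * v)"
        by (simp add: exp_add[symmetric] algebra_simps)
      ultimately show "of_real y * ?f t x (x + y * v) = iexp (t * x) * (poisson_kernel 1 v *\<^sub>R iexp (t * y * v))"
        by (metis mult_scaleR_right scaleR_scaleR scaleR_conv_of_real)
    qed
    also have "\<dots> = iexp (t * x) * char standard_cauchy_distribution (t * y)"
      unfolding char_standard_cauchy by (rule integral_mult_right_zero)
    finally show ?thesis .
  qed
  have "(\<integral>u. poisson_smoothing y u *\<^sub>R iexp (t * u) \<partial>lborel) = (\<integral>u. (\<integral>x. ?f t x u \<partial>M) \<partial>lborel)"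
    unfolding sm ..
  also have "\<dots> = (\<integral>x. (\<integral>u. ?f t x u \<partial>lborel) \<partial>M)" by (rule Fubini_integral[OF int])
  also have "\<dots> = char M t * char standard_cauchy_distribution (t * y)"
    unfolding inner char_def[of M] by (rule integral_mult_left_zero)
  finally show "(\<integral>u. poisson_smoothing y u *\<^sub>R iexp (t * u) \<partial>lborel)
        = char M t * char standard_cauchy_distribution (t * y)" .
qed

lemma integral_poisson_smoothing:
  assumes y: "0 < y" shows "(\<integral>u. poisson_smoothing y u \<partial>lborel) = 1"
proof -
  interpret C: real_distribution standard_cauchy_distribution by (rule real_distribution_standard_cauchy)
  have "complex_of_real (\<integral>u. poisson_smoothing y u \<partial>lborel) = 1"
    using fourier_poisson_smoothing[OF y, of 0] C.char_zero char_zero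
    by (simp add: scaleR_conv_of_real)
  then show ?thesis by simp
qed

end

text \<open>The positive part of \<open>g - f n\<close> lies below \<open>g\<close>, so dominated
  convergence applies to it; equality of the total masses forces the negative part to have the same
  integral.\<close>

lemma scheffe:
  fixes f :: "nat \<Rightarrow> 'a \<Rightarrow> real"
  assumes f: "\<And>n. integrable M (f n)" and g: "integrable M g"
    and nonneg: "\<And>n x. 0 \<le> f n x" "\<And>x. 0 \<le> g x"
    and eq: "\<And>n. integral\<^sup>L M (f n) = integral\<^sup>L M g"
    and lim: "\<And>x. (\<lambda>n. f n x) \<longlonglongrightarrow> g x"
  shows "(\<lambda>n. \<integral>x. \<bar>f n x - g x\<bar> \<partial>M) \<longlonglongrightarrow> 0"
proof -
  have [measurable]: "f n \<in> borel_measurable M" "g \<in> borel_measurable M" for n using f g by auto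
  have "(\<lambda>n. \<integral>x. max 0 (g x - f n x) \<partial>M) \<longlonglongrightarrow> (\<integral>x. 0 \<partial>M)"
  proof (rule integral_dominated_convergence[OF _ _ g])
    show "AE x in M. (\<lambda>n. max 0 (g x - f n x)) \<longlonglongrightarrow> 0"
    proof (rule AE_I2)
      fix x
      have "(\<lambda>n. max 0 (g x - f n x)) \<longlonglongrightarrow> max 0 (g x - g x)" by (intro tendsto_intros lim)
      then show "(\<lambda>n. max 0 (g x - f n x)) \<longlonglongrightarrow> 0" by simp
    qed
    show "AE x in M. norm (max 0 (g x - f n x)) \<le> g x" for n using nonneg by auto
  qed auto
  then have "(\<lambda>n. 2 * (\<integral>x. max 0 (g x - f n x) \<partial>M)) \<longlonglongrightarrow> 2 * (\<integral>x. 0 \<partial>M)"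
    by (intro tendsto_intros)
  moreover have "2 * (\<integral>x. max 0 (g x - f n x) \<partial>M) = (\<integral>x. \<bar>f n x - g x\<bar> \<partial>M)" for n
  proof -
    have "integrable M (\<lambda>x. max 0 (g x - f n x))" using f g by auto
    then have "(\<integral>x. 2 * max 0 (g x - f n x) - (g x - f n x) \<partial>M) = 2 * (\<integral>x. max 0 (g x - f n x) \<partial>M)"
      using f g eq by simp
    moreover have "\<bar>f n x - g x\<bar> = 2 * max 0 (g x - f n x) - (g x - f n x)" for x by (simp add: max_def)
    ultimately show ?thesis by simp
  qed
  ultimately show ?thesis by simp
qed

text \<open>
  Convolving with a Cauchy law turns the Cauchy transforms into densities, so that Scheffe's
  lemma applies; its characteristic function is nonzero near the origin and can be divided out.
\<close>

lemma weak_conv_cauchy_transform: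
  assumes N: "\<And>n. real_distribution (N n)" and M: "real_distribution M"
    and lim: "\<And>z. 0 < Im z \<Longrightarrow> (\<lambda>n. Im (cauchy_transform (N n) z)) \<longlonglongrightarrow> Im (cauchy_transform M z)"
  shows "weak_conv_m N M"
proof (rule levy_continuity[OF N M])
  fix t
  interpret N: real_distribution "N n" for n by fact
  interpret M: real_distribution M by fact
  interpret C: real_distribution standard_cauchy_distribution by (rule real_distribution_standard_cauchy)
  let ?c = "char standard_cauchy_distribution"
  have "((\<lambda>y. ?c (t * y)) \<longlongrightarrow> ?c 0) (at_right 0)"
    by (rule isCont_tendsto_compose[OF C.isCont_char]) (auto intro!: tendsto_eq_intros)
  then have "((\<lambda>y. ?c (t * y)) \<longlongrightarrow> 1) (at_right 0)" by (simp add: C.char_zero)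
  then have "\<forall>\<^sub>F y in at_right 0. ?c (t * y) \<noteq> 0" by (rule tendsto_imp_eventually_ne) simp
  then have "\<forall>\<^sub>F y in at_right 0. ?c (t * y) \<noteq> 0 \<and> 0 < y"
    using eventually_at_right_less[of 0] by eventually_elim auto
  \<comment> \<open>The scale \<open>y\<close> may depend on \<open>t\<close>: characteristic
    functions are compared one frequency at a time.\<close>
  then obtain y where y: "0 < y" and c: "?c (t * y) \<noteq> 0"
    using eventually_happens'[OF trivial_limit_at_right_real] by blast
  let ?d = "\<lambda>n u. N.poisson_smoothing n y u - M.poisson_smoothing y u"
  have L1: "(\<lambda>n. \<integral>u. \<bar>?d n u\<bar> \<partial>lborel) \<longlonglongrightarrow> 0"
  proof (rule scheffe)
    show "(\<lambda>n. N.poisson_smoothing n y u) \<longlonglongrightarrow> M.poisson_smoothing y u" for u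
      unfolding N.poisson_smoothing_eq[OF y] M.poisson_smoothing_eq[OF y]
      by (intro tendsto_intros lim) (use y in auto)
  qed (use y N.integrable_poisson_smoothing M.integrable_poisson_smoothing N.poisson_smoothing_nonneg
      M.poisson_smoothing_nonneg N.integral_poisson_smoothing M.integral_poisson_smoothing in auto)
  have "(\<lambda>n. char (N n) t * ?c (t * y) - char M t * ?c (t * y)) \<longlonglongrightarrow> 0"
  proof (rule Lim_null_comparison[OF _ L1], rule always_eventually, rule allI)
    fix n
    have i: "integrable lborel (\<lambda>u. f u *\<^sub>R iexp (t * u))" if "integrable lborel f" for f :: "real \<Rightarrow> real"
      by (rule Bochner_Integration.integrable_bound[OF that]) (use that in auto)
    note iN = N.integrable_poisson_smoothing[OF y, of n] and iM = M.integrable_poisson_smoothing[OF y]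
    have "char (N n) t * ?c (t * y) - char M t * ?c (t * y)
        = (\<integral>u. ?d n u *\<^sub>R iexp (t * u) \<partial>lborel)"
      unfolding N.fourier_poisson_smoothing[OF y, symmetric] M.fourier_poisson_smoothing[OF y, symmetric]
      using i[OF iN] i[OF iM] by (simp add: scaleR_diff_left)
    also have "cmod \<dots> \<le> (\<integral>u. norm (?d n u *\<^sub>R iexp (t * u)) \<partial>lborel)" by (rule integral_norm_bound)
    finally show "norm (char (N n) t * ?c (t * y) - char M t * ?c (t * y)) \<le> (\<integral>u. \<bar>?d n u\<bar> \<partial>lborel)"
      by simp
  qed
  then have "(\<lambda>n. char (N n) t * ?c (t * y)) \<longlonglongrightarrow> char M t * ?c (t * y)" by (rule LIM_zero_cancel)
  then have "(\<lambda>n. char (N n) t * ?c (t * y) / ?c (t * y)) \<longlonglongrightarrow> char M t * ?c (t * y) / ?c (t * y)"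
    by (rule tendsto_divide[OF _ tendsto_const c])
  then show "(\<lambda>n. char (N n) t) \<longlonglongrightarrow> char M t" by (simp only: nonzero_mult_div_cancel_right[OF c])
qed

lemma converges_weakly_cauchy_transform:
  fixes N :: "real \<Rightarrow> real measure"
  assumes N: "\<forall>\<^sub>F t in at_top. real_distribution (N t)" and M: "real_distribution M"
    and lim: "\<And>z. 0 < Im z \<Longrightarrow> ((\<lambda>t. Im (cauchy_transform (N t) z)) \<longlongrightarrow> Im (cauchy_transform M z)) at_top"
  shows "converges_weakly N M at_top"
  unfolding converges_weakly_def
proof (intro allI impI tendsto_at_topI_sequentially)
  fix f :: "real \<Rightarrow> real" and X :: "nat \<Rightarrow> real"
  assume f: "continuous_on UNIV f \<and> bounded (range f)" and X: "filterlim X at_top sequentially"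
  obtain B where B: "\<And>x. norm (f x) \<le> B" using f by (auto simp: bounded_iff)
  have "\<forall>\<^sub>F n in sequentially. real_distribution (N (X n))"
    using eventually_compose_filterlim[OF N X] .
  then obtain k where k: "\<And>n. k \<le> n \<Longrightarrow> real_distribution (N (X n))"
    unfolding eventually_sequentially by blast
  \<comment> \<open>Dropping the first \<open>k\<close> terms leaves a sequence consisting of
    distributions only; the limit does not see the shift.\<close>
  have X': "filterlim (\<lambda>n. X (n + k)) at_top sequentially"
    using filterlim_compose[OF X filterlim_add_const_nat_at_top] by simp
  have d: "real_distribution (N (X (n + k)))" for n by (rule k) simp
  have "weak_conv_m (\<lambda>n. N (X (n + k))) M"
    by (rule weak_conv_cauchy_transform[OF d M]) (rule filterlim_compose[OF lim X'])
  then have "(\<lambda>n. integral\<^sup>L (N (X (n + k))) f) \<longlonglongrightarrow> integral\<^sup>L M f"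
    by (rule weak_conv_imp_integral_bdd_continuous_conv[OF d M])
      (use f B in \<open>auto simp: continuous_on_eq_continuous_at\<close>)
  then show "(\<lambda>n. integral\<^sup>L (N (X n)) f) \<longlonglongrightarrow> integral\<^sup>L M f" by (rule LIMSEQ_offset)
qed

subsection \<open>Subordination and convolution powers\<close>

lemma open_truncated_cone: "open (truncated_cone \<kappa> R)"
proof -
  have "truncated_cone \<kappa> R = {z. 0 < Im z} \<inter> {z. \<bar>Re z\<bar> < \<kappa> * Im z} \<inter> {z. R < Im z}"
    by (auto simp: truncated_cone_def)
  also have "open \<dots>"
    by (intro open_Int open_Collect_less continuous_intros)
  finally show ?thesis .
qed

text \<open>At \<open>z = \<i> y\<close> the bound makes \<open>F z / z - 1\<close> of order
  \<open>1 / y\<^sup>2\<close>; the estimate on \<open>K\<close> supplies such a bound for both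
  powers.\<close>

lemma F_transform_exists_bound:
  assumes hol: "F holomorphic_on upper_half_plane"
    and im: "\<And>z. 0 < Im z \<Longrightarrow> Im z \<le> Im (F z)"
    and bd: "\<And>z. 0 < Im z \<Longrightarrow> cmod (F z - z) \<le> C / Im z"
  obtains N where "real_distribution N" "\<And>z. 0 < Im z \<Longrightarrow> F_transform N z = F z"
proof (rule F_transform_exists[OF hol im])
  show "((\<lambda>y. F (\<i> * of_real y) / (\<i> * of_real y)) \<longlongrightarrow> 1) at_top"
  proof (rule LIM_zero_cancel, rule Lim_null_comparison)
    show "\<forall>\<^sub>F y in at_top. norm (F (\<i> * of_real y) / (\<i> * of_real y) - 1) \<le> C / y / y"
      using eventually_gt_at_top[of 0]
    proof eventually_elim
      fix y :: real assume y: "0 < y"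
      have "F (\<i> * of_real y) / (\<i> * of_real y) - 1 = (F (\<i> * of_real y) - \<i> * of_real y) / (\<i> * of_real y)"
        using y by (simp add: diff_divide_distrib)
      then show "norm (F (\<i> * of_real y) / (\<i> * of_real y) - 1) \<le> C / y / y"
        using divide_right_mono[OF bd[of "\<i> * of_real y"], of y] y by (simp add: norm_divide norm_mult)
    qed
    show "((\<lambda>y. C / y / y) \<longlongrightarrow> 0) at_top" by real_asymp
  qed
qed (use that in auto)

text \<open>An inverse on a full half-plane with bounded displacement \<open>f z - z\<close> serves
  every cone at once, because \<open>\<bar>f z / z - 1\<bar> \<le> C / \<bar>z\<bar>\<close> in all
  directions.\<close>

lemma is_F_right_inverseI:
  assumes R: "0 \<le> R" and hol: "f holomorphic_on {z. R < Im z}"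
    and pos: "\<And>z. R < Im z \<Longrightarrow> 0 < Im (f z)"
    and inv: "\<And>z. R < Im z \<Longrightarrow> F_transform N (f z) = z"
    and bd: "\<And>z. R < Im z \<Longrightarrow> cmod (f z - z) \<le> C"
  shows "is_F_right_inverse N \<kappa> R f"
  unfolding is_F_right_inverse_def
proof (intro conjI ballI allI impI)
  have "f holomorphic_on truncated_cone \<kappa> R"
    by (rule holomorphic_on_subset[OF hol]) (auto simp: truncated_cone_def)
  then show "f analytic_on truncated_cone \<kappa> R"
    by (simp add: analytic_on_open open_truncated_cone)
  show "f ` truncated_cone \<kappa> R \<subseteq> upper_half_plane" using pos by (auto simp: truncated_cone_def)
  show "F_transform N (f z) = z" if "z \<in> truncated_cone \<kappa> R" for z
    using inv that by (simp add: truncated_cone_def)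
  fix \<beta> :: real
  let ?F = "inf at_infinity (principal {z \<in> truncated_cone \<kappa> R. \<bar>Re z\<bar> < \<beta> * Im z})"
  show "((\<lambda>z. f z / z) \<longlongrightarrow> 1) ?F"
  proof (rule LIM_zero_cancel, rule Lim_null_comparison)
    show "\<forall>\<^sub>F z in ?F. norm (f z / z - 1) \<le> C * cmod (1 / z)"
      unfolding eventually_inf_principal
    proof (intro always_eventually allI impI)
      fix z assume "z \<in> {z \<in> truncated_cone \<kappa> R. \<bar>Re z\<bar> < \<beta> * Im z}"
      then have z: "R < Im z" by (simp add: truncated_cone_def)
      then have "z \<noteq> 0" using R by auto
      then have "f z / z - 1 = (f z - z) * (1 / z)" by (simp add: field_simps)
      then show "norm (f z / z - 1) \<le> C * cmod (1 / z)"
        using bd[OF z] by (simp only: norm_mult) (intro mult_right_mono, auto)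
    qed
    have "((\<lambda>z::complex. inverse z) \<longlongrightarrow> 0) at_infinity" by (rule tendsto_inverse_0)
    then have "((\<lambda>z::complex. C * cmod (inverse z)) \<longlongrightarrow> C * cmod 0) at_infinity" by (intro tendsto_intros)
    then show "((\<lambda>z. C * cmod (1 / z)) \<longlongrightarrow> 0) ?F"
      by (intro tendsto_mono[OF inf_le1]) (simp add: inverse_eq_divide)
  qed
qed

text \<open>
  \<open>\<bar>g h\<bar> \<le> \<eta> \<bar>h\<bar>\<^sup>2 + min \<bar>g h\<bar> (g\<^sup>2 / (4 \<eta>))\<close>: the first term is uniformly small, the second one
  is dominated.
\<close>

lemma tendsto_integral_mult_L2:
  fixes h :: "real \<Rightarrow> 'a \<Rightarrow> 'b::{banach, second_countable_topology, real_normed_field}"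
  assumes [measurable]: "g \<in> borel_measurable M" "\<And>t. h t \<in> borel_measurable M"
    and g: "integrable M (\<lambda>x. (norm (g x))\<^sup>2)"
    and h: "\<forall>\<^sub>F t in at_top. integrable M (\<lambda>x. (norm (h t x))\<^sup>2) \<and> (\<integral>x. (norm (h t x))\<^sup>2 \<partial>M) \<le> C"
    and lim: "\<And>x. ((\<lambda>t. h t x) \<longlongrightarrow> 0) at_top"
  shows "((\<lambda>t. \<integral>x. g x * h t x \<partial>M) \<longlongrightarrow> 0) at_top"
proof (rule tendstoI)
  fix \<epsilon> :: real assume \<epsilon>: "0 < \<epsilon>"
  \<comment> \<open>This makes \<open>\<eta> * C\<close> at most \<open>\<epsilon> / 2\<close>; the
    integral of \<open>d t\<close> will eventually be below \<open>\<epsilon> / 4\<close>.\<close>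
  define \<eta> where "\<eta> = \<epsilon> / (2 * (\<bar>C\<bar> + 1))"
  have \<eta>: "0 < \<eta>" using \<epsilon> by (simp add: \<eta>_def)
  have \<eta>C: "\<eta> * C < \<epsilon> / 2 + \<epsilon> / 4"
  proof -
    have "\<eta> * C \<le> \<eta> * (\<bar>C\<bar> + 1)" using \<eta> by (intro mult_left_mono) auto
    also have "\<dots> = \<epsilon> / 2" by (simp add: \<eta>_def field_simps)
    finally show ?thesis using \<epsilon> by simp
  qed
  define d where "d t x = min (norm (g x * h t x)) ((norm (g x))\<^sup>2 / (4 * \<eta>))" for t x
  have [measurable]: "d t \<in> borel_measurable M" for t unfolding d_def by measurable
  have d0: "0 \<le> d t x" for t x using \<eta> by (simp add: d_def)
  have dg: "d t x \<le> (norm (g x))\<^sup>2 / (4 * \<eta>)" for t x by (simp add: d_def)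
  have gi: "integrable M (\<lambda>x. (norm (g x))\<^sup>2 / (4 * \<eta>))" using g by simp
  have di: "integrable M (d t)" for t
    by (rule Bochner_Integration.integrable_bound[OF gi]) (use d0 dg \<eta> in auto)
  have "((\<lambda>t. \<integral>x. d t x \<partial>M) \<longlongrightarrow> (\<integral>x. 0 \<partial>M)) at_top"
  proof (rule integral_dominated_convergence_at_top[OF _ _ gi])
    show "AE x in M. ((\<lambda>t. d t x) \<longlongrightarrow> 0) at_top"
    proof (rule AE_I2)
      fix x
      have "((\<lambda>t. d t x) \<longlongrightarrow> min (norm (g x * 0)) ((norm (g x))\<^sup>2 / (4 * \<eta>))) at_top"
        unfolding d_def by (intro tendsto_intros lim)
      then show "((\<lambda>t. d t x) \<longlongrightarrow> 0) at_top" using \<eta> by (simp add: min_def)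
    qed
    show "\<forall>\<^sub>F t in at_top. AE x in M. norm (d t x) \<le> (norm (g x))\<^sup>2 / (4 * \<eta>)"
      using d0 dg by simp
  qed auto
  then have "\<forall>\<^sub>F t in at_top. (\<integral>x. d t x \<partial>M) < \<epsilon> / 4"
    using \<epsilon> by (intro order_tendstoD(2)) auto
  then show "\<forall>\<^sub>F t in at_top. dist (\<integral>x. g x * h t x \<partial>M) 0 < \<epsilon>"
    using h
  proof eventually_elim
    fix t assume d: "(\<integral>x. d t x \<partial>M) < \<epsilon> / 4"
      and h: "integrable M (\<lambda>x. (norm (h t x))\<^sup>2) \<and> (\<integral>x. (norm (h t x))\<^sup>2 \<partial>M) \<le> C"
    have pointwise: "norm (g x * h t x) \<le> \<eta> * (norm (h t x))\<^sup>2 + d t x" for x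
    proof -
      have "0 \<le> (norm (g x) - 2 * \<eta> * norm (h t x))\<^sup>2 / (4 * \<eta>)" using \<eta> by simp
      also have "\<dots> = (norm (g x))\<^sup>2 / (4 * \<eta>) + \<eta> * (norm (h t x))\<^sup>2 - norm (g x) * norm (h t x)"
        using \<eta> by (simp add: power2_eq_square field_simps)
      finally have "norm (g x * h t x) \<le> (norm (g x))\<^sup>2 / (4 * \<eta>) + \<eta> * (norm (h t x))\<^sup>2"
        by (simp add: norm_mult)
      then show ?thesis using \<eta> by (simp add: d_def min_def)
    qed
    have i: "integrable M (\<lambda>x. g x * h t x)" by (rule integrable_mult_L2) (use g h in auto)
    have "norm (\<integral>x. g x * h t x \<partial>M) \<le> (\<integral>x. norm (g x * h t x) \<partial>M)" by (rule integral_norm_bound)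
    also have "\<dots> \<le> (\<integral>x. \<eta> * (norm (h t x))\<^sup>2 + d t x \<partial>M)"
      using pointwise i h di by (intro integral_mono) auto
    also have "\<dots> = \<eta> * (\<integral>x. (norm (h t x))\<^sup>2 \<partial>M) + (\<integral>x. d t x \<partial>M)" using h di by simp
    also have "\<dots> \<le> \<eta> * C + (\<integral>x. d t x \<partial>M)" using h \<eta> by (simp add: mult_left_mono)
    also have "\<dots> < \<epsilon>" using \<eta>C d by simp
    finally show "dist (\<integral>x. g x * h t x \<partial>M) 0 < \<epsilon>" by simp
  qed
qed

section \<open>Laws with mean 0 and variance 1: estimates for \<open>K\<close>\<close>

locale standardized_distribution = real_distribution +
  assumes integrable_square: "integrable M (\<lambda>x. x\<^sup>2)"
    and mean: "expectation (\<lambda>x. x) = 0"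
    and second_moment: "expectation (\<lambda>x. x\<^sup>2) = 1"
begin

definition K :: "complex \<Rightarrow> complex" where
  "K z = F_transform M z - z"

lemma integrable_id: "integrable M (\<lambda>x. x)"
  by (rule square_integrable_imp_integrable[OF _ integrable_square]) simp

lemma holomorphic_K: "K holomorphic_on upper_half_plane"
  unfolding K_def by (intro holomorphic_intros holomorphic_F_transform)

lemma Im_K_nonneg: "0 < Im z \<Longrightarrow> 0 \<le> Im (K z)"
  using Im_F_transform_ge[of z] by (simp add: K_def)

lemma F_residual_eq: "0 < Im z \<Longrightarrow> F_residual z x = (K z + of_real x) / (z - of_real x)"
  using diff_of_real_neq_0[of z x] by (simp add: F_residual_def K_def field_simps)

lemma expectation_norm_F_residual:
  "0 < Im z \<Longrightarrow> expectation (\<lambda>x. (cmod (F_residual z x))\<^sup>2) = Im (K z) / Im z"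
  by (simp add: expectation_F_residual_square K_def)

lemma integrable_id_mult:
  assumes [measurable]: "f \<in> borel_measurable M" and "integrable M (\<lambda>x. (cmod (f x))\<^sup>2)"
  shows "integrable M (\<lambda>x. of_real x * f x)"
    and "(cmod (\<integral>x. of_real x * f x \<partial>M))\<^sup>2 \<le> (\<integral>x. (cmod (f x))\<^sup>2 \<partial>M)"
  using integrable_mult_L2[of complex_of_real M f] Cauchy_Schwarz_integral[of complex_of_real M f]
    assms integrable_square second_moment by auto

text \<open>Integrate \<open>(z - x) * b z = K z + x\<close>: the mean of \<open>b z\<close>
  vanishes, and centring removes the mean of \<open>x\<close>.\<close>

lemma expectation_id_mult_F_residual:
  assumes z: "0 < Im z" shows "(\<integral>x. of_real x * F_residual z x \<partial>M) = - K z"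
proof -
  have "z * F_residual z x - of_real x * F_residual z x = K z + of_real x" for x
  proof -
    have "F_residual z x * (z - of_real x) = K z + of_real x"
      using diff_of_real_neq_0[of z x] z by (simp add: F_residual_eq[OF z])
    then show ?thesis by (simp add: algebra_simps)
  qed
  then have "(\<integral>x. z * F_residual z x - of_real x * F_residual z x \<partial>M) = (\<integral>x. K z + of_real x \<partial>M)"
    by simp
  moreover have "(\<integral>x. z * F_residual z x - of_real x * F_residual z x \<partial>M)
      = z * expectation (F_residual z) - (\<integral>x. of_real x * F_residual z x \<partial>M)"
    using integrable_id_mult(1)[OF _ integrable_F_residual_square[OF z]] integrable_F_residual[OF z] by simp
  moreover have "(\<integral>x. K z + complex_of_real x \<partial>M) = K z"
    using integrable_id mean by (simp add: prob_UNIV)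
  ultimately have "- (\<integral>x. of_real x * F_residual z x \<partial>M) = K z" using expectation_F_residual[OF z] by simp
  then show ?thesis by (metis minus_minus)
qed

lemma norm_K_square: "0 < Im z \<Longrightarrow> (cmod (K z))\<^sup>2 \<le> Im (K z) / Im z"
  using integrable_id_mult(2)[OF _ integrable_F_residual_square] expectation_norm_F_residual
    expectation_id_mult_F_residual by fastforce

lemma norm_K_le:
  assumes z: "0 < Im z" shows "cmod (K z) \<le> 1 / Im z"
proof (cases "K z = 0")
  case False
  have "cmod (K z) * cmod (K z) \<le> cmod (K z) / Im z"
    using norm_K_square[OF z] divide_right_mono[OF order_trans[OF abs_ge_self abs_Im_le_cmod[of "K z"]], of "Im z"] z
    by (simp add: power2_eq_square)
  then show ?thesis using False z by (simp add: field_simps)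
qed (use z in simp)

text \<open>The Lipschitz factor is the geometric mean of \<open>Im (K u) / Im u\<close> at the two
  endpoints. It refers to nothing between them, so it can be used for two solutions about which only
  their own equations are known.\<close>

lemma K_diff_le:
  assumes z: "0 < Im z" and w: "0 < Im w"
  shows "(cmod (K z - K w))\<^sup>2 \<le> (cmod (z - w))\<^sup>2 * (Im (K z) / Im z * (Im (K w) / Im w))"
proof -
  have "(cmod (\<integral>x. F_residual z x * F_residual w x \<partial>M))\<^sup>2 \<le> Im (K z) / Im z * (Im (K w) / Im w)"
    using Cauchy_Schwarz_integral[of "F_residual z" M "F_residual w"]
      integrable_F_residual_square[OF z] integrable_F_residual_square[OF w]
    unfolding expectation_norm_F_residual[OF z] expectation_norm_F_residual[OF w] by simp
  moreover have "K z - K w = (z - w) * (\<integral>x. F_residual z x * F_residual w x \<partial>M)"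
    using F_transform_diff[OF z w] by (simp only: K_def)
  ultimately show ?thesis by (simp only: norm_mult power_mult_distrib) (intro mult_left_mono, auto)
qed

text \<open>Imaginary parts of the equation give \<open>c * Im (K u) < Im u\<close> at each
  solution, because \<open>Im z > 0\<close>. By \<open>K_diff_le\<close> two distinct solutions
  would then be strictly closer to each other than they are.\<close>

lemma subordination_unique:
  assumes "0 \<le> c" "0 < Im z" and w: "0 < Im w" "w = z + of_real c * K w"
    and v: "0 < Im v" "v = z + of_real c * K v"
  shows "w = v"
proof (rule ccontr)
  assume "w \<noteq> v"
  have *: "0 \<le> c * (Im (K u) / Im u) \<and> c * (Im (K u) / Im u) < 1"
    if "0 < Im u" "u = z + of_real c * K u" for u
  proof -
    have "Im u = Im z + c * Im (K u)" using arg_cong[OF that(2), of Im] by simp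
    then have "c * Im (K u) < Im u" using assms(2) by simp
    then show ?thesis using that(1) assms(1) Im_K_nonneg[OF that(1)] by (simp add: divide_simps)
  qed
  have "w - v = of_real c * (K w - K v)"
    using w(2) v(2) by (metis add_diff_cancel_left right_diff_distrib)
  then have "(cmod (w - v))\<^sup>2 = c\<^sup>2 * (cmod (K w - K v))\<^sup>2"
    by (simp add: norm_mult power_mult_distrib)
  also have "\<dots> \<le> c\<^sup>2 * ((cmod (w - v))\<^sup>2 * (Im (K w) / Im w * (Im (K v) / Im v)))"
    by (intro mult_left_mono K_diff_le w v) auto
  also have "\<dots> = (cmod (w - v))\<^sup>2 * ((c * (Im (K w) / Im w)) * (c * (Im (K v) / Im v)))"
    by (simp add: power2_eq_square)
  also have "\<dots> < (cmod (w - v))\<^sup>2 * 1"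
  proof (rule mult_strict_left_mono)
    show "(c * (Im (K w) / Im w)) * (c * (Im (K v) / Im v)) < 1"
      using *[OF w] *[OF v] mult_strict_mono'[of "c * (Im (K w) / Im w)" 1 "c * (Im (K v) / Im v)" 1] by simp
  qed (use \<open>w \<noteq> v\<close> in simp)
  finally show False by simp
qed

text \<open>Brouwer's theorem covers every \<open>z\<close>; \<open>c K\<close> is a contraction only for large \<open>Im z\<close>.\<close>

lemma subordination_exists:
  assumes c: "0 \<le> c" and z: "0 < Im z"
  obtains w where "Im z \<le> Im w" "w = z + of_real c * K w"
proof -
  \<comment> \<open>On \<open>S\<close> one has
    \<open>\<bar>K w\<bar> \<le> 1 / Im w \<le> 1 / Im z\<close>, so the map lands within
    \<open>c / Im z\<close> of \<open>z\<close>; as \<open>Im (K w) \<ge> 0\<close>, it also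
    respects the lower bound on the imaginary part.\<close>
  define S where "S = {w. Im z \<le> Im w} \<inter> cball z (c / Im z)"
  have S: "0 < Im w" if "w \<in> S" for w using that z by (auto simp: S_def)
  have "S \<subseteq> upper_half_plane" using S by auto
  then have cont: "continuous_on S K"
    using holomorphic_on_imp_continuous_on[OF holomorphic_K] continuous_on_subset by blast
  obtain w where w: "w \<in> S" "z + of_real c * K w = w"
  proof (rule brouwer[of S "\<lambda>w. z + of_real c * K w"])
    show "compact S"
      unfolding S_def by (intro closed_Int_compact closed_halfspace_Im_ge compact_cball)
    show "convex S" unfolding S_def by (intro convex_Int convex_halfspace_Im_ge convex_cball)
    have "z \<in> S" using c z by (simp add: S_def)
    then show "S \<noteq> {}" by blast
    show "continuous_on S (\<lambda>w. z + of_real c * K w)" by (intro continuous_intros cont)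
    show "(\<lambda>w. z + of_real c * K w) \<in> S \<rightarrow> S"
    proof
      fix w assume "w \<in> S"
      then have w: "0 < Im w" "Im z \<le> Im w" using S by (auto simp: S_def)
      have "c * cmod (K w) \<le> c * (1 / Im z)"
        using norm_K_le[OF w(1)] w z c
        by (intro mult_left_mono order_trans[OF norm_K_le[OF w(1)]]) (auto simp: frac_le)
      then show "z + of_real c * K w \<in> S"
        using Im_K_nonneg[OF w(1)] c by (simp add: S_def dist_norm norm_mult)
    qed
  qed (use that in auto)
  then show ?thesis using that[of w] by (simp add: S_def)
qed

text \<open>The subordination function of the free power of order \<open>1 + c\<close>; meaningful
  for \<open>0 \<le> c\<close> and \<open>0 < Im z\<close>, where the solution exists and is
  unique.\<close>

definition \<omega> :: "real \<Rightarrow> complex \<Rightarrow> complex" where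
  "\<omega> c z = (THE w. 0 < Im w \<and> w = z + of_real c * K w)"

lemma
  assumes c: "0 \<le> c" and z: "0 < Im z"
  shows \<omega>_fixed_point: "\<omega> c z = z + of_real c * K (\<omega> c z)"
    and Im_\<omega>_ge: "Im z \<le> Im (\<omega> c z)"
    and \<omega>_unique: "0 < Im w \<Longrightarrow> w = z + of_real c * K w \<Longrightarrow> \<omega> c z = w"
proof -
  obtain v where v: "Im z \<le> Im v" "v = z + of_real c * K v" by (rule subordination_exists[OF c z])
  have v0: "0 < Im v" using v z by simp
  show *: "\<omega> c z = w" if "0 < Im w" "w = z + of_real c * K w" for w
    unfolding \<omega>_def using that subordination_unique[OF c z] by (intro the_equality) blast+
  show "\<omega> c z = z + of_real c * K (\<omega> c z)" "Im z \<le> Im (\<omega> c z)"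
    using *[OF v0 v(2)] v by auto
qed

lemma Im_\<omega>_pos: "0 \<le> c \<Longrightarrow> 0 < Im z \<Longrightarrow> 0 < Im (\<omega> c z)"
  using Im_\<omega>_ge[of c z] by simp

text \<open>\<open>\<omega> c\<close> inverts \<open>H w = w - c * K w\<close>, and an injective
  holomorphic map has a holomorphic inverse. \<open>H\<close> may leave the upper half-plane, so it
  is restricted to the part \<open>U\<close> that it maps back into it; there the uniqueness of
  solutions amounts to injectivity of \<open>H\<close>.\<close>

lemma holomorphic_\<omega>:
  assumes c: "0 \<le> c" shows "\<omega> c holomorphic_on upper_half_plane"
proof -
  define H where "H w = w - of_real c * K w" for w
  define U where "U = upper_half_plane \<inter> H -` upper_half_plane"
  have H: "H holomorphic_on upper_half_plane"
    unfolding H_def by (intro holomorphic_intros holomorphic_K)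
  have "open U"
    unfolding U_def
    by (intro continuous_open_preimage holomorphic_on_imp_continuous_on H open_upper_half_plane)
  have \<omega>H: "\<omega> c (H w) = w" if "w \<in> U" for w
    using that by (intro \<omega>_unique c) (auto simp: U_def H_def)
  have \<omega>U: "\<omega> c z \<in> U" "H (\<omega> c z) = z" if "z \<in> upper_half_plane" for z
  proof -
    show "H (\<omega> c z) = z" using \<omega>_fixed_point[OF c, of z] that unfolding H_def by (simp add: algebra_simps)
    then show "\<omega> c z \<in> U" using that Im_\<omega>_pos[OF c] by (simp add: U_def)
  qed
  have "inj_on H U" using \<omega>H by (rule inj_on_inverseI)
  have HU: "H ` U = upper_half_plane"
  proof
    show "H ` U \<subseteq> upper_half_plane" by (auto simp: U_def)
    show "upper_half_plane \<subseteq> H ` U" using \<omega>U by (metis image_eqI subsetI)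
  qed
  have HolU: "H holomorphic_on U" by (rule holomorphic_on_subset[OF H]) (auto simp: U_def)
  obtain g where g: "g holomorphic_on (H ` U)" "\<And>w. w \<in> U \<Longrightarrow> g (H w) = w"
    using holomorphic_has_inverse[OF HolU \<open>open U\<close> \<open>inj_on H U\<close>] by metis
  have "\<omega> c z = g z" if "z \<in> upper_half_plane" for z using g(2)[OF \<omega>U(1)[OF that]] \<omega>U(2)[OF that] by simp
  then show ?thesis by (intro holomorphic_transform[OF g(1)[unfolded HU]]) simp
qed

text \<open>Where \<open>Im w \<ge> 1\<close> one has \<open>\<bar>K w\<bar> \<le> 1\<close>. A
  preimage of \<open>z\<close> is a fixed point of \<open>w \<mapsto> z - K w\<close>, which maps
  the closed unit ball around \<open>z\<close> into itself when \<open>Im z > 3\<close>. Equal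
  values of F at two points would give \<open>\<bar>K z - K w\<bar> = \<bar>z - w\<bar>\<close>,
  against the Lipschitz factor below 1 on \<open>V\<close>.\<close>

lemma F_transform_right_inverse:
  obtains f where "f holomorphic_on {z. 3 < Im z}"
    "\<And>z. 3 < Im z \<Longrightarrow> 1 < Im (f z)" "\<And>z. 3 < Im z \<Longrightarrow> F_transform M (f z) = z"
    "\<And>z. 3 < Im z \<Longrightarrow> cmod (f z - z) \<le> 1"
proof -
  define V where "V = {w. 1 < Im w}"
  have hol: "F_transform M holomorphic_on V"
    by (rule holomorphic_on_subset[OF holomorphic_F_transform]) (auto simp: V_def)
  have K1: "cmod (K w) \<le> 1" if "1 \<le> Im w" for w
    using norm_K_le[of w] that by (intro order_trans[OF norm_K_le]) (auto simp: field_simps)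
  have inj: "inj_on (F_transform M) V"
  proof (rule inj_onI, rule ccontr)
    fix z w assume zw: "z \<in> V" "w \<in> V" "F_transform M z = F_transform M w" "z \<noteq> w"
    have *: "0 \<le> Im (K u) / Im u \<and> Im (K u) / Im u < 1" if "u \<in> V" for u
    proof -
      have u: "1 < Im u" using that by (simp add: V_def)
      then have "Im (K u) \<le> 1" using order_trans[OF order_trans[OF abs_ge_self abs_Im_le_cmod] K1[of u]] by simp
      then show ?thesis using u Im_K_nonneg[of u] by (simp add: divide_simps)
    qed
    have "K z - K w = w - z" using zw(3) by (simp add: K_def)
    then have "(cmod (z - w))\<^sup>2 \<le> (cmod (z - w))\<^sup>2 * (Im (K z) / Im z * (Im (K w) / Im w))"
      using K_diff_le[of z w] zw by (simp add: V_def norm_minus_commute)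
    also have "\<dots> < (cmod (z - w))\<^sup>2 * 1"
    proof (rule mult_strict_left_mono)
      show "Im (K z) / Im z * (Im (K w) / Im w) < 1"
        using *[OF zw(1)] *[OF zw(2)] mult_strict_mono'[of "Im (K z) / Im z" 1 "Im (K w) / Im w" 1] by simp
    qed (use zw in simp)
    finally show False by simp
  qed
  have ex: "\<exists>w\<in>V. F_transform M w = z \<and> cmod (w - z) \<le> 1" if z: "3 < Im z" for z
  proof -
    have S: "2 < Im w" if "w \<in> cball z 1" for w
      using abs_Im_le_cmod[of "z - w"] that z by (simp add: dist_norm)
    have "cball z 1 \<subseteq> upper_half_plane" using S by force
    then have cont: "continuous_on (cball z 1) K"
      using holomorphic_on_imp_continuous_on[OF holomorphic_K] continuous_on_subset by blast
    obtain w where w: "w \<in> cball z 1" "z - K w = w"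
    proof (rule brouwer[of "cball z 1" "\<lambda>w. z - K w"])
      show "continuous_on (cball z 1) (\<lambda>w. z - K w)" by (intro continuous_intros cont)
      show "(\<lambda>w. z - K w) \<in> cball z 1 \<rightarrow> cball z 1"
      proof
        fix w assume "w \<in> cball z 1"
        then have "1 \<le> Im w" using S by force
        then show "z - K w \<in> cball z 1" using K1 by (simp add: dist_norm)
      qed
    qed (use that in auto)
    have "F_transform M w = z" using w(2) by (simp add: K_def algebra_simps)
    moreover have "cmod (w - z) \<le> 1" using w(1) by (simp add: dist_norm norm_minus_commute)
    moreover have "w \<in> V" using S[OF w(1)] by (simp add: V_def)
    ultimately show ?thesis by blast
  qed
  have "open V" by (simp add: V_def open_halfspace_Im_gt)
  then obtain f where f: "f holomorphic_on (F_transform M ` V)" "\<And>w. w \<in> V \<Longrightarrow> f (F_transform M w) = w"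
    using holomorphic_has_inverse[OF hol _ inj] by metis
  show ?thesis
  proof (rule that[of f])
    show "f holomorphic_on {z. 3 < Im z}" by (rule holomorphic_on_subset[OF f(1)]) (use ex in force)
    fix z assume z: "3 < Im z"
    from ex[OF z] obtain w where w: "w \<in> V" "F_transform M w = z" "cmod (w - z) \<le> 1" by blast
    then have "f z = w" using f(2) by auto
    then show "1 < Im (f z)" "F_transform M (f z) = z" "cmod (f z - z) \<le> 1" using w by (auto simp: V_def)
  qed
qed

section \<open>F-transforms of the free and Boolean powers\<close>

lemma F_\<omega>_eq:
  assumes "0 \<le> c" "0 < Im z"
  shows "F_transform M (\<omega> c z) = z + of_real (1 + c) * K (\<omega> c z)"
  using \<omega>_fixed_point[OF assms] by (simp add: K_def algebra_simps)

lemma norm_K_\<omega>_le: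
  assumes "0 \<le> c" "0 < Im z" shows "cmod (K (\<omega> c z)) \<le> 1 / Im z"
  using Im_\<omega>_ge[OF assms] assms
  by (intro order_trans[OF norm_K_le[OF Im_\<omega>_pos[OF assms]]]) (auto simp: frac_le)

lemma F_transform_free_power_exists:
  assumes c: "0 \<le> c"
  obtains N where "real_distribution N" "\<And>z. 0 < Im z \<Longrightarrow> F_transform N z = F_transform M (\<omega> c z)"
proof (rule F_transform_exists_bound[of "\<lambda>z. F_transform M (\<omega> c z)" "1 + c"])
  show "(\<lambda>z. F_transform M (\<omega> c z)) holomorphic_on upper_half_plane"
    by (rule holomorphic_on_compose_gen[OF holomorphic_\<omega>[OF c] holomorphic_F_transform, unfolded o_def])
      (use Im_\<omega>_pos[OF c] in auto)
  fix z :: complex assume z: "0 < Im z"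
  show "Im z \<le> Im (F_transform M (\<omega> c z))"
    using Im_\<omega>_ge[OF c z] Im_F_transform_ge[OF Im_\<omega>_pos[OF c z]] by linarith
  have "(1 + c) * cmod (K (\<omega> c z)) \<le> (1 + c) * (1 / Im z)"
    using norm_K_\<omega>_le[OF c z] c by (intro mult_left_mono) auto
  moreover have "cmod (of_real (1 + c)) = 1 + c" using c by (simp only: norm_of_real)
  ultimately show "cmod (F_transform M (\<omega> c z) - z) \<le> (1 + c) / Im z"
    unfolding F_\<omega>_eq[OF c z] by (simp only: add_diff_cancel_left' norm_mult) simp
qed (rule that)

text \<open>The bridge between the two descriptions of the free power. If \<open>w\<close> and
  \<open>v\<close> are the preimages of \<open>z\<close> under the F-transforms of \<open>M\<close>
  and of its power, then \<open>v - z = (1 + c) * (w - z)\<close> is the proportionality of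
  Voiculescu transforms, and \<open>K w = z - w\<close> turns it into
  \<open>w = v + c * K w\<close>.\<close>

lemma \<omega>_right_inverse:
  assumes c: "0 \<le> c" and w: "0 < Im w" "F_transform M w = z"
    and v: "0 < Im v" "v - z = of_real (1 + c) * (w - z)"
  shows "\<omega> c v = w"
proof (rule \<omega>_unique[OF c v(1) w(1)])
  have "K w = z - w" using w(2) by (simp add: K_def)
  moreover have "v = z + of_real (1 + c) * (w - z)" using v(2) by (simp add: algebra_simps)
  ultimately show "w = v + of_real c * K w" by (simp only:) (simp add: algebra_simps)
qed

lemma is_free_power_exists:
  assumes c: "0 \<le> c" obtains N where "is_free_power (1 + c) M N"
proof -
  obtain N where N: "real_distribution N" "\<And>z. 0 < Im z \<Longrightarrow> F_transform N z = F_transform M (\<omega> c z)"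
    using F_transform_free_power_exists[OF c] by metis
  obtain f where f: "f holomorphic_on {z. 3 < Im z}" "\<And>z. 3 < Im z \<Longrightarrow> 1 < Im (f z)"
    "\<And>z. 3 < Im z \<Longrightarrow> F_transform M (f z) = z" "\<And>z. 3 < Im z \<Longrightarrow> cmod (f z - z) \<le> 1"
    using F_transform_right_inverse by metis
  \<comment> \<open>The only candidate for the inverse belonging to the power. It displaces points
    by at most \<open>1 + c\<close>, so the height \<open>3 + c\<close> keeps its values in the
    upper half-plane.\<close>
  define f' where "f' z = z + of_real (1 + c) * (f z - z)" for z
  let ?R = "3 + c"
  have hol: "f holomorphic_on {z. ?R < Im z}" by (rule holomorphic_on_subset[OF f(1)]) (use c in auto)
  have bd: "cmod (f' z - z) \<le> 1 + c" if "?R < Im z" for z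
  proof -
    have "cmod (of_real (1 + c)) = 1 + c" using c by (simp only: norm_of_real)
    then show ?thesis using f(4)[of z] that c mult_left_mono[of "cmod (f z - z)" 1 "1 + c"]
      by (simp only: f'_def add_diff_cancel_left' norm_mult) simp
  qed
  have pos: "0 < Im (f' z)" if "?R < Im z" for z
    using bd[OF that] abs_Im_le_cmod[of "f' z - z"] that by simp
  have "is_F_right_inverse M 1 ?R f"
    by (rule is_F_right_inverseI[OF _ hol, where C=1]) (use f c in \<open>auto intro: less_trans[of 0 1]\<close>)
  moreover have "is_F_right_inverse N 1 ?R f'"
  proof (rule is_F_right_inverseI[OF _ _ pos _ bd])
    show "f' holomorphic_on {z. ?R < Im z}" unfolding f'_def by (intro holomorphic_intros hol)
    fix z assume z: "?R < Im z"
    have "\<omega> c (f' z) = f z"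
      by (rule \<omega>_right_inverse[OF c _ _ pos[OF z], of _ z]) (use z c f(2)[of z] f(3)[of z] in \<open>auto simp: f'_def\<close>)
    then show "F_transform N (f' z) = z" using N(2)[OF pos[OF z]] f(3) z c by simp
  qed (use c in auto)
  ultimately have "is_voiculescu_transform M 1 ?R (\<lambda>z. f z - z)"
    "is_voiculescu_transform N 1 ?R (\<lambda>z. f' z - z)"
    unfolding is_voiculescu_transform_def by blast+
  moreover have "f' z - z = of_real (1 + c) * (f z - z)" for z by (simp add: f'_def)
  moreover have "(0::real) < 1" "0 < ?R" using c by auto
  ultimately have "is_free_power (1 + c) M N"
    unfolding is_free_power_def using N(1) by blast
  then show ?thesis by (rule that)
qed

text \<open>The definition compares the measures on a truncated cone only. There the inverse
  \<open>g\<close> of the F-transform of \<open>N\<close> is injective and holomorphic, so it has an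
  open image, on which \<open>\<omega>_right_inverse\<close> identifies the two functions; the
  identity theorem extends this to the half-plane.\<close>

lemma F_transform_is_free_power:
  assumes c: "0 \<le> c" and free: "is_free_power (1 + c) M N" and z: "0 < Im z"
  shows "F_transform N z = F_transform M (\<omega> c z)"
proof -
  interpret N: real_distribution N using free by (simp add: is_free_power_def)
  obtain \<kappa> R \<phi> \<psi> where \<kappa>: "0 < \<kappa>" and R: "0 < R" and \<phi>: "is_voiculescu_transform M \<kappa> R \<phi>"
    and \<psi>: "is_voiculescu_transform N \<kappa> R \<psi>"
    and eq: "\<And>z. z \<in> truncated_cone \<kappa> R \<Longrightarrow> \<psi> z = of_real (1 + c) * \<phi> z"
    using free unfolding is_free_power_def by blast
  obtain f where f: "is_F_right_inverse M \<kappa> R f" "\<And>z. z \<in> truncated_cone \<kappa> R \<Longrightarrow> \<phi> z = f z - z"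
    using \<phi> unfolding is_voiculescu_transform_def by blast
  obtain g where g: "is_F_right_inverse N \<kappa> R g" "\<And>z. z \<in> truncated_cone \<kappa> R \<Longrightarrow> \<psi> z = g z - z"
    using \<psi> unfolding is_voiculescu_transform_def by blast
  let ?T = "truncated_cone \<kappa> R"
  have gT: "0 < Im (g w)" "F_transform N (g w) = w" if "w \<in> ?T" for w
    using g(1) that by (auto simp: is_F_right_inverse_def)
  have fT: "0 < Im (f w)" "F_transform M (f w) = w" if "w \<in> ?T" for w
    using f(1) that by (auto simp: is_F_right_inverse_def)
  have hol: "g holomorphic_on ?T" using g(1) by (simp add: is_F_right_inverse_def analytic_imp_holomorphic)
  have "inj_on g ?T" by (rule inj_on_inverseI[of _ "F_transform N"]) (use gT in auto)
  then have op: "open (g ` ?T)" by (rule open_mapping_thm3[OF hol open_truncated_cone])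
  have "\<i> * of_real (R + 1) \<in> ?T" using \<kappa> R by (simp add: truncated_cone_def)
  then have ne: "g ` ?T \<noteq> {}" by blast
  show ?thesis
  proof (rule analytic_continuation_open[where f="F_transform N" and g="\<lambda>z. F_transform M (\<omega> c z)", OF op open_upper_half_plane ne connected_upper_half_plane])
    show "g ` ?T \<subseteq> upper_half_plane" using gT by auto
    show "F_transform N holomorphic_on upper_half_plane" by (rule N.holomorphic_F_transform)
    show "(\<lambda>z. F_transform M (\<omega> c z)) holomorphic_on upper_half_plane"
      by (rule holomorphic_on_compose_gen[OF holomorphic_\<omega>[OF c] holomorphic_F_transform, unfolded o_def])
        (use Im_\<omega>_pos[OF c] in auto)
    fix v assume "v \<in> g ` ?T"
    then obtain w where w: "w \<in> ?T" "v = g w" by blast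
    have "g w - w = of_real (1 + c) * (f w - w)" using eq[OF w(1)] f(2)[OF w(1)] g(2)[OF w(1)] by simp
    then have "\<omega> c v = f w"
      unfolding w(2) by (intro \<omega>_right_inverse[OF c fT[OF w(1)] gT(1)[OF w(1)]])
    then show "F_transform N v = F_transform M (\<omega> c v)" using fT gT w by simp
  qed (use z in simp)
qed

text \<open>The F-transform of the free power exceeds \<open>z\<close> by
  \<open>(1 + t) * K (\<omega> t z)\<close>, and the Boolean exponent \<open>1 / (1 + t)\<close>
  rescales exactly this excess.\<close>

lemma belinschi_nica_F_transform:
  assumes t: "0 \<le> t"
  shows "real_distribution (belinschi_nica t M)"
    and "\<And>z. 0 < Im z \<Longrightarrow> F_transform (belinschi_nica t M) z = z + K (\<omega> t z)"
proof -
  define N where "N = free_power M (1 + t)"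
  have "is_free_power (1 + t) M N"
    unfolding N_def free_power_def using is_free_power_exists[OF t] by (metis someI_ex)
  then have FN: "F_transform N z = z + of_real (1 + t) * K (\<omega> t z)" if "0 < Im z" for z
    using F_transform_is_free_power[OF t _ that] F_\<omega>_eq[OF t that] by simp
  have FB: "of_real (1 / (1 + t)) * F_transform N z + of_real (1 - 1 / (1 + t)) * z = z + K (\<omega> t z)"
    if "0 < Im z" for z
  proof -
    have "complex_of_real (1 / (1 + t)) * of_real (1 + t) = 1"
      using t by (simp only: of_real_mult[symmetric]) simp
    then have "of_real (1 / (1 + t)) * (z + of_real (1 + t) * K (\<omega> t z)) = of_real (1 / (1 + t)) * z + K (\<omega> t z)"
      by (metis distrib_left mult.assoc mult_1)
    then show ?thesis unfolding FN[OF that] by (simp add: algebra_simps)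
  qed
  have "\<exists>B. is_boolean_power (1 / (1 + t)) N B"
  proof (rule F_transform_exists_bound[of "\<lambda>z. z + K (\<omega> t z)" 1])
    show "(\<lambda>z. z + K (\<omega> t z)) holomorphic_on upper_half_plane"
      by (intro holomorphic_intros holomorphic_on_compose_gen[OF holomorphic_\<omega>[OF t] holomorphic_K, unfolded o_def])
        (use Im_\<omega>_pos[OF t] in auto)
    show "Im z \<le> Im (z + K (\<omega> t z))" if "0 < Im z" for z
      using Im_K_nonneg[OF Im_\<omega>_pos[OF t that]] by simp
    show "cmod (z + K (\<omega> t z) - z) \<le> 1 / Im z" if "0 < Im z" for z
      using norm_K_\<omega>_le[OF t that] by simp
  qed (use FB in \<open>auto simp: is_boolean_power_def\<close>)
  \<comment> \<open>The Boolean equation prescribes the F-transform on the whole half-plane, so it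
    holds for whichever measure the choice operator returns.\<close>
  then have "is_boolean_power (1 / (1 + t)) N (belinschi_nica t M)"
    unfolding belinschi_nica_def N_def[symmetric] boolean_power_def by (rule someI_ex)
  then show "real_distribution (belinschi_nica t M)"
    and "\<And>z. 0 < Im z \<Longrightarrow> F_transform (belinschi_nica t M) z = z + K (\<omega> t z)"
    using FB by (auto simp: is_boolean_power_def)
qed

subsection \<open>The scaling limit\<close>

lemma expectation_abs_pos: "0 < expectation (\<lambda>x. \<bar>x\<bar>)"
proof (rule ccontr)
  assume "\<not> 0 < expectation (\<lambda>x. \<bar>x\<bar>)"
  moreover have "0 \<le> expectation (\<lambda>x. \<bar>x\<bar>)" by (rule integral_nonneg_AE) simp
  ultimately have "expectation (\<lambda>x. \<bar>x\<bar>) = 0" by linarith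
  then have "AE x in M. \<bar>x\<bar> = 0"
    using integral_nonneg_eq_0_iff_AE[of M "\<lambda>x. \<bar>x\<bar>"] integrable_abs[OF integrable_id] by simp
  then have "AE x in M. x\<^sup>2 = 0" by simp
  then have "expectation (\<lambda>x. x\<^sup>2) = expectation (\<lambda>x. 0)" by (intro integral_cong_AE) auto
  then show False using second_moment by simp
qed

text \<open>A lower bound for \<open>\<bar>z\<bar>\<close> in disguise: if \<open>K z\<close> and
  \<open>Im (K z) / Im z\<close> are small, \<open>\<bar>z\<bar>\<close> must be large. The
  difference on the left is at most the mean of
  \<open>\<bar>K z + x\<bar> = \<bar>b z\<bar> * \<bar>z - x\<bar>\<close>, and Cauchy-Schwarz
  applies with \<open>E \<bar>z - x\<bar>\<^sup>2 = \<bar>z\<bar>\<^sup>2 + 1\<close>.\<close>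

lemma expectation_abs_minus_norm_K_le:
  assumes z: "0 < Im z" and le: "cmod (K z) \<le> expectation (\<lambda>x. \<bar>x\<bar>)"
  shows "(expectation (\<lambda>x. \<bar>x\<bar>) - cmod (K z))\<^sup>2 \<le> Im (K z) / Im z * ((cmod z)\<^sup>2 + 1)"
proof -
  have sq: "(cmod (z - of_real x))\<^sup>2 = (cmod z)\<^sup>2 - 2 * Re z * x + x\<^sup>2" for x
    unfolding cmod_power2 by (simp add: power2_eq_square algebra_simps)
  have i: "integrable M (\<lambda>x. (cmod (z - of_real x))\<^sup>2)"
    unfolding sq using integrable_id integrable_square by simp
  have e: "expectation (\<lambda>x. (cmod (z - of_real x))\<^sup>2) = (cmod z)\<^sup>2 + 1"
    unfolding sq using integrable_id integrable_square mean second_moment by (simp add: prob_UNIV)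
  have b: "cmod (F_residual z x) * cmod (z - of_real x) = cmod (K z + of_real x)" for x
    using diff_of_real_neq_0[of z x] z by (simp add: F_residual_eq[OF z] norm_divide)
  have iK: "integrable M (\<lambda>x. cmod (K z + of_real x))" using integrable_id by simp
  have "expectation (\<lambda>x. \<bar>x\<bar>) - cmod (K z) = expectation (\<lambda>x. \<bar>x\<bar> - cmod (K z))"
    using integrable_abs[OF integrable_id] by (simp add: prob_UNIV)
  also have "\<dots> \<le> expectation (\<lambda>x. cmod (K z + of_real x))"
  proof (rule integral_mono)
    show "\<bar>x\<bar> - cmod (K z) \<le> cmod (K z + of_real x)" for x
      using norm_triangle_ineq4[of "K z + of_real x" "K z"] by simp
  qed (use iK integrable_abs[OF integrable_id] in auto)
  finally have "(expectation (\<lambda>x. \<bar>x\<bar>) - cmod (K z))\<^sup>2 \<le> (expectation (\<lambda>x. cmod (K z + of_real x)))\<^sup>2"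
    using le by (intro power_mono) auto
  also have "\<dots> = (norm (\<integral>x. cmod (F_residual z x) * cmod (z - of_real x) \<partial>M))\<^sup>2" unfolding b by simp
  also have "\<dots> \<le> Im (K z) / Im z * ((cmod z)\<^sup>2 + 1)"
    using Cauchy_Schwarz_integral[of "\<lambda>x. cmod (F_residual z x)" M "\<lambda>x. cmod (z - of_real x)"]
      integrable_F_residual_square[OF z] i by (simp add: e expectation_norm_F_residual[OF z])
  finally show ?thesis .
qed

section \<open>The fixed point at the scaled argument\<close>

context
  fixes z :: complex
  assumes z: "0 < Im z"
begin

text \<open>The division by \<open>sqrt (1 + t)\<close> comes from the dilation: the F-transform of
  a law dilated by \<open>c > 0\<close> is \<open>c * F (z / c)\<close>.\<close>

definition W :: "real \<Rightarrow> complex" where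
  "W t = \<omega> t (z / of_real (sqrt (1 + t)))"

lemma Im_scaled_pos: "0 \<le> t \<Longrightarrow> 0 < Im (z / of_real (sqrt (1 + t)))"
  using z by simp

lemma Im_W_pos: "0 \<le> t \<Longrightarrow> 0 < Im (W t)"
  unfolding W_def by (intro Im_\<omega>_pos Im_scaled_pos) auto

lemma W_eq: "0 \<le> t \<Longrightarrow> W t = z / of_real (sqrt (1 + t)) + of_real t * K (W t)"
  unfolding W_def by (intro \<omega>_fixed_point Im_scaled_pos) auto

lemma Im_K_W_le:
  assumes t: "1 \<le> t" shows "Im (K (W t)) / Im (W t) \<le> 1 / t"
proof -
  have "Im (W t) = Im (z / of_real (sqrt (1 + t))) + t * Im (K (W t))"
    using arg_cong[OF W_eq[of t], of Im] t by simp
  then have "t * Im (K (W t)) \<le> Im (W t)" using Im_scaled_pos[of t] t by simp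
  then show ?thesis using t Im_W_pos[of t] by (simp add: field_simps)
qed

lemma norm_K_W_le:
  assumes t: "1 \<le> t" shows "cmod (K (W t)) \<le> 1 / sqrt t"
proof (rule power2_le_imp_le)
  show "(cmod (K (W t)))\<^sup>2 \<le> (1 / sqrt t)\<^sup>2"
    using order_trans[OF norm_K_square[OF Im_W_pos] Im_K_W_le[OF t]] t by (simp add: power_divide)
qed (use t in simp)

lemma norm_W_le:
  assumes t: "1 \<le> t" shows "cmod (W t) \<le> (cmod z + 1) * sqrt t"
proof -
  have "cmod (W t) \<le> cmod (z / of_real (sqrt (1 + t))) + cmod (of_real t * K (W t))"
    using W_eq[of t] t norm_triangle_ineq[of "z / of_real (sqrt (1 + t))" "of_real t * K (W t)"] by simp
  also have "cmod (z / of_real (sqrt (1 + t))) \<le> cmod z * sqrt t"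
  proof -
    have "1 \<le> sqrt (1 + t)" "1 \<le> sqrt t" using t by auto
    then have "cmod z / sqrt (1 + t) \<le> cmod z" "cmod z \<le> cmod z * sqrt t"
      using mult_left_mono[of 1 "sqrt (1 + t)" "cmod z"] mult_left_mono[of 1 "sqrt t" "cmod z"]
      by (auto simp: divide_le_eq)
    then show ?thesis using t by (simp add: norm_divide)
  qed
  also have "cmod (of_real t * K (W t)) \<le> t * (1 / sqrt t)"
    using norm_K_W_le[OF t] t by (simp only: norm_mult norm_of_real) (intro mult_mono, auto)
  also have "t * (1 / sqrt t) = sqrt t" using t by (simp add: real_div_sqrt)
  finally show ?thesis by (simp add: algebra_simps)
qed

text \<open>Once \<open>\<bar>K (W t)\<bar>\<close> is at most half of
  \<open>E \<bar>x\<bar>\<close>, \<open>expectation_abs_minus_norm_K_le\<close> gives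
  \<open>\<bar>W t\<bar>\<^sup>2 + 1 \<ge> t * (E \<bar>x\<bar> / 2)\<^sup>2\<close>.\<close>

lemma norm_W_at_top: "filterlim (\<lambda>t. cmod (W t)) at_top at_top"
proof -
  let ?m = "expectation (\<lambda>x. \<bar>x\<bar>)"
  have m: "0 < ?m" by (rule expectation_abs_pos)
  have "((\<lambda>t. 1 / sqrt t) \<longlongrightarrow> 0) at_top" by real_asymp
  then have "\<forall>\<^sub>F t in at_top. 1 / sqrt t < ?m / 2" using m by (intro order_tendstoD) auto
  then have ev: "\<forall>\<^sub>F t in at_top. sqrt (t * (?m / 2)\<^sup>2 - 1) \<le> cmod (W t)"
    using eventually_ge_at_top[of 1]
  proof eventually_elim
    fix t :: real assume "1 / sqrt t < ?m / 2" and t: "1 \<le> t"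
    then have K: "cmod (K (W t)) \<le> ?m / 2" using norm_K_W_le[OF t] by simp
    have W: "0 < Im (W t)" using Im_W_pos t by simp
    have "(?m / 2)\<^sup>2 \<le> (?m - cmod (K (W t)))\<^sup>2" using K m by (intro power_mono) auto
    also have "\<dots> \<le> Im (K (W t)) / Im (W t) * ((cmod (W t))\<^sup>2 + 1)"
      using expectation_abs_minus_norm_K_le[OF W] K m by simp
    also have "\<dots> \<le> 1 / t * ((cmod (W t))\<^sup>2 + 1)"
      using Im_K_W_le[OF t] by (intro mult_right_mono) auto
    finally have "t * (?m / 2)\<^sup>2 \<le> (cmod (W t))\<^sup>2 + 1" using t by (simp add: field_simps)
    then show "sqrt (t * (?m / 2)\<^sup>2 - 1) \<le> cmod (W t)" by (intro real_le_lsqrt) auto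
  qed
  have "filterlim (\<lambda>t. t * a - 1) at_top at_top" if "0 < a" for a :: real
    using that by real_asymp
  from this[of "(?m / 2)\<^sup>2"] have "filterlim (\<lambda>t. t * (?m / 2)\<^sup>2 - 1) at_top at_top"
    using m by simp
  then have "filterlim (\<lambda>t. sqrt (t * (?m / 2)\<^sup>2 - 1)) at_top at_top"
    by (rule filterlim_compose[OF sqrt_at_top])
  then show ?thesis using ev by (rule filterlim_at_top_mono)
qed

text \<open>\<open>h\<close> measures how far \<open>W t * b (W t)\<close> is from \<open>x\<close>,
  and \<open>E (x * h t) = 1 + W t * K (W t)\<close>. As \<open>1 / (W t - x)\<close> might be large
  for \<open>W t\<close> near the real line, a bound in mean square takes the place of a dominating
  function for \<open>h\<close>.\<close>

lemma W_K_tendsto: "((\<lambda>t. W t * K (W t)) \<longlongrightarrow> -1) at_top"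
proof -
  define h where "h t x = of_real x - W t * F_residual (W t) x" for t x
  have [measurable]: "h t \<in> borel_measurable borel" for t unfolding h_def by measurable
  \<comment> \<open>From \<open>\<bar>a - b\<bar>\<^sup>2 \<le> 2 * (\<bar>a\<bar>\<^sup>2 +
    \<bar>b\<bar>\<^sup>2)\<close> and \<open>E (x\<^sup>2) = 1\<close>; the growth
    \<open>\<bar>W t\<bar>\<^sup>2 = O(t)\<close> cancels the factor \<open>1 / t\<close> in the
    mean square of \<open>b (W t)\<close>.\<close>
  let ?C = "2 * (1 + (cmod z + 1)\<^sup>2)"
  have WK: "cmod (W t * K (W t)) \<le> cmod z + 1" if t: "1 \<le> t" for t
  proof -
    have "cmod (W t) * cmod (K (W t)) \<le> ((cmod z + 1) * sqrt t) * (1 / sqrt t)"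
      using norm_W_le[OF t] norm_K_W_le[OF t] t by (intro mult_mono) auto
    then show ?thesis using t by (simp add: norm_mult)
  qed
  have "((\<lambda>t. \<integral>x. of_real x * h t x \<partial>M) \<longlongrightarrow> 0) at_top"
  proof (rule tendsto_integral_mult_L2)
    show "integrable M (\<lambda>x. (cmod (of_real x))\<^sup>2)" using integrable_square by simp
    show "\<forall>\<^sub>F t in at_top. integrable M (\<lambda>x. (cmod (h t x))\<^sup>2) \<and> (\<integral>x. (cmod (h t x))\<^sup>2 \<partial>M) \<le> ?C"
      using eventually_ge_at_top[of 1]
    proof eventually_elim
      fix t :: real assume t: "1 \<le> t"
      then have W: "0 < Im (W t)" using Im_W_pos by simp
      let ?b = "\<lambda>x. 2 * (x\<^sup>2 + (cmod (W t))\<^sup>2 * (cmod (F_residual (W t) x))\<^sup>2)"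
      have le: "(cmod (h t x))\<^sup>2 \<le> ?b x" for x
      proof -
        have "(cmod (h t x))\<^sup>2 \<le> (cmod (of_real x) + cmod (W t * F_residual (W t) x))\<^sup>2"
          unfolding h_def by (intro power_mono norm_triangle_ineq4) auto
        also have "\<dots> \<le> 2 * ((cmod (of_real x))\<^sup>2 + (cmod (W t * F_residual (W t) x))\<^sup>2)"
          using sum_squares_bound[of "cmod (of_real x)" "cmod (W t * F_residual (W t) x)"]
          by (simp add: power2_sum)
        finally show ?thesis by (simp add: norm_mult power_mult_distrib)
      qed
      have ib: "integrable M ?b" using integrable_square integrable_F_residual_square[OF W] by simp
      have ih: "integrable M (\<lambda>x. (cmod (h t x))\<^sup>2)"
      proof (rule Bochner_Integration.integrable_bound[OF ib])
        show "AE x in M. norm ((cmod (h t x))\<^sup>2) \<le> norm (?b x)"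
          using le by (auto intro: order_trans[OF _ abs_ge_self])
      qed measurable
      have "(\<integral>x. (cmod (h t x))\<^sup>2 \<partial>M) \<le> expectation ?b" using le ib ih by (intro integral_mono) auto
      also have "\<dots> = 2 * (1 + (cmod (W t))\<^sup>2 * (Im (K (W t)) / Im (W t)))"
        using integrable_square integrable_F_residual_square[OF W] second_moment
        by (simp add: expectation_norm_F_residual[OF W])
      also have "\<dots> \<le> 2 * (1 + ((cmod z + 1) * sqrt t)\<^sup>2 * (1 / t))"
        using Im_K_W_le[OF t] Im_K_nonneg[OF W] W t norm_W_le[OF t]
        by (intro mult_left_mono add_left_mono mult_mono power_mono) auto
      also have "\<dots> = ?C" using t by (simp add: power_mult_distrib)
      finally show "integrable M (\<lambda>x. (cmod (h t x))\<^sup>2) \<and> (\<integral>x. (cmod (h t x))\<^sup>2 \<partial>M) \<le> ?C"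
        using ih by simp
    qed
    fix x
    show "((\<lambda>t. h t x) \<longlongrightarrow> 0) at_top"
    proof (rule Lim_null_comparison)
      show "\<forall>\<^sub>F t in at_top. norm (h t x) \<le> (x\<^sup>2 + (cmod z + 1)) * inverse (- \<bar>x\<bar> + cmod (W t))"
        using eventually_ge_at_top[of 1] filterlim_at_top_dense[THEN iffD1, OF norm_W_at_top, rule_format, of "\<bar>x\<bar>"]
      proof eventually_elim
        fix t :: real assume t: "1 \<le> t" and x: "\<bar>x\<bar> < cmod (W t)"
        then have W: "0 < Im (W t)" using Im_W_pos by simp
        have ne: "W t - of_real x \<noteq> 0" using diff_of_real_neq_0 W by simp
        \<comment> \<open>Multiplying by \<open>W t - x\<close> cancels the terms
          \<open>W t * x\<close> and leaves a numerator bounded in \<open>t\<close>.\<close>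
        have "h t x * (W t - of_real x) = - (of_real (x\<^sup>2) + W t * K (W t))"
        proof -
          have "F_residual (W t) x * (W t - of_real x) = K (W t) + of_real x"
            using ne by (simp add: F_residual_eq[OF W])
          then have "h t x * (W t - of_real x)
              = of_real x * (W t - of_real x) - W t * (K (W t) + of_real x)"
            unfolding h_def by (simp only: left_diff_distrib mult.assoc)
          then show ?thesis by (simp add: algebra_simps power2_eq_square)
        qed
        then have "cmod (h t x) * cmod (W t - of_real x) = cmod (of_real (x\<^sup>2) + W t * K (W t))"
          by (metis norm_minus_cancel norm_mult)
        also have "\<dots> \<le> x\<^sup>2 + (cmod z + 1)"
          using WK[OF t] norm_triangle_ineq[of "of_real (x\<^sup>2)" "W t * K (W t)"] by (simp only: norm_of_real) simp
        finally have 1: "cmod (h t x) * cmod (W t - of_real x) \<le> x\<^sup>2 + (cmod z + 1)" .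
        have "cmod (W t) - \<bar>x\<bar> \<le> cmod (W t - of_real x)"
          using norm_triangle_ineq2[of "W t" "of_real x"] by simp
        then have "cmod (h t x) * (cmod (W t) - \<bar>x\<bar>) \<le> x\<^sup>2 + (cmod z + 1)"
          using mult_left_mono[of "cmod (W t) - \<bar>x\<bar>" "cmod (W t - of_real x)" "cmod (h t x)"] 1 by simp
        then show "norm (h t x) \<le> (x\<^sup>2 + (cmod z + 1)) * inverse (- \<bar>x\<bar> + cmod (W t))"
          using x by (simp add: field_simps)
      qed
      have "filterlim (\<lambda>t. - \<bar>x\<bar> + cmod (W t)) at_top at_top"
        by (rule filterlim_tendsto_add_at_top[OF tendsto_const norm_W_at_top])
      then have "((\<lambda>t. inverse (- \<bar>x\<bar> + cmod (W t))) \<longlongrightarrow> 0) at_top"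
        by (rule tendsto_inverse_0_at_top)
      then show "((\<lambda>t. (x\<^sup>2 + (cmod z + 1)) * inverse (- \<bar>x\<bar> + cmod (W t))) \<longlongrightarrow> 0) at_top"
        by (rule tendsto_mult_right_zero)
    qed
  qed measurable
  moreover have "\<forall>\<^sub>F t in at_top. (\<integral>x. of_real x * h t x \<partial>M) = 1 + W t * K (W t)"
    using eventually_ge_at_top[of 0]
  proof eventually_elim
    fix t :: real assume t: "0 \<le> t"
    then have W: "0 < Im (W t)" by (rule Im_W_pos)
    have "(\<integral>x. of_real x * h t x \<partial>M)
        = (\<integral>x. of_real (x\<^sup>2) - W t * (of_real x * F_residual (W t) x) \<partial>M)"
      by (intro Bochner_Integration.integral_cong refl)
        (simp add: h_def algebra_simps power2_eq_square)
    also have "\<dots> = (\<integral>x. complex_of_real (x\<^sup>2) \<partial>M) - W t * (\<integral>x. of_real x * F_residual (W t) x \<partial>M)"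
      using integrable_square integrable_id_mult(1)[OF _ integrable_F_residual_square[OF W]]
      by (subst Bochner_Integration.integral_diff) (auto simp del: of_real_power)
    also have "\<dots> = 1 + W t * K (W t)"
      unfolding expectation_id_mult_F_residual[OF W] integral_complex_of_real second_moment by simp
    finally show "(\<integral>x. of_real x * h t x \<partial>M) = 1 + W t * K (W t)" .
  qed
  ultimately have "((\<lambda>t. 1 + W t * K (W t)) \<longlongrightarrow> 0) at_top"
    using tendsto_cong by fastforce
  then have "((\<lambda>t. 1 + W t * K (W t) - 1) \<longlongrightarrow> 0 - 1) at_top" by (intro tendsto_intros)
  then show ?thesis by simp
qed

text \<open>The fixed point equation gives \<open>(W t)\<^sup>2 \<approx> t * W t * K (W t) \<approx> - t\<close>.\<close>

lemma W_scaled_tendsto: "((\<lambda>t. W t / of_real (sqrt (1 + t))) \<longlongrightarrow> \<i>) at_top"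
proof -
  define V where "V t = W t / of_real (sqrt (1 + t))" for t
  have Vbd: "cmod (V t) \<le> cmod z + 1" if t: "1 \<le> t" for t
  proof -
    have "cmod (W t) \<le> (cmod z + 1) * sqrt (1 + t)"
      using norm_W_le[OF t] t mult_left_mono[of "sqrt t" "sqrt (1 + t)" "cmod z + 1"] by simp
    then show ?thesis using t by (simp add: V_def norm_divide divide_le_eq)
  qed
  have Veq: "(V t)\<^sup>2 = of_real (t / (1 + t)) * (W t * K (W t)) + V t * (z * of_real (1 / (1 + t)))"
    if t: "1 \<le> t" for t
  proof -
    define c where "c = complex_of_real (sqrt (1 + t))"
    have c: "c \<noteq> 0" "c * c = of_real (1 + t)"
      using t by (auto simp: c_def simp flip: of_real_mult)
    have "(V t)\<^sup>2 = W t * W t / (c * c)" by (simp add: V_def c_def power2_eq_square)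
    also have "\<dots> = W t * (z / c + of_real t * K (W t)) / (c * c)"
      using W_eq[of t] t by (simp add: c_def)
    also have "\<dots> = of_real t / (c * c) * (W t * K (W t)) + V t * (z / (c * c))"
      using c(1) by (simp add: V_def c_def[symmetric] field_simps)
    finally show ?thesis unfolding c(2) by simp
  qed
  have "((\<lambda>t. of_real (t / (1 + t)) * (W t * K (W t)) + V t * (z * of_real (1 / (1 + t))))
      \<longlongrightarrow> of_real 1 * (-1) + 0) at_top"
  proof (intro tendsto_add tendsto_mult tendsto_of_real W_K_tendsto)
    show "((\<lambda>t::real. t / (1 + t)) \<longlongrightarrow> 1) at_top" by real_asymp
    show "((\<lambda>t. V t * (z * of_real (1 / (1 + t)))) \<longlongrightarrow> 0) at_top"
    proof (rule Lim_null_comparison)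
      show "\<forall>\<^sub>F t in at_top. norm (V t * (z * of_real (1 / (1 + t)))) \<le> (cmod z + 1) * cmod z * (1 / (1 + t))"
        using eventually_ge_at_top[of 1]
      proof eventually_elim
        fix t :: real assume t: "1 \<le> t"
        have "norm (V t * (z * of_real (1 / (1 + t)))) = cmod (V t) * (cmod z * (1 / (1 + t)))"
          using t by (simp only: norm_mult norm_of_real) simp
        also have "\<dots> \<le> (cmod z + 1) * (cmod z * (1 / (1 + t)))"
          using Vbd[OF t] t by (intro mult_right_mono) auto
        finally show "norm (V t * (z * of_real (1 / (1 + t)))) \<le> (cmod z + 1) * cmod z * (1 / (1 + t))"
          by (simp only: mult.assoc)
      qed
      show "((\<lambda>t. (cmod z + 1) * cmod z * (1 / (1 + t))) \<longlongrightarrow> 0) at_top" by real_asymp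
    qed
  qed
  then have "((\<lambda>t. (V t)\<^sup>2) \<longlongrightarrow> of_real 1 * (-1) + 0) at_top"
    by (rule Lim_transform_eventually) (use eventually_ge_at_top[of 1] in eventually_elim, simp only: Veq)
  then have "((\<lambda>t. (V t)\<^sup>2 + 1) \<longlongrightarrow> of_real 1 * (-1) + 0 + 1) at_top" by (intro tendsto_intros)
  then have sq: "((\<lambda>t. (V t)\<^sup>2 + 1) \<longlongrightarrow> 0) at_top" by simp
  \<comment> \<open>Of the two square roots of -1 the limit has to be \<open>\<i>\<close>:
    \<open>V t\<close> has positive imaginary part and so stays at distance at least 1 from
    \<open>- \<i>\<close>.\<close>
  have "((\<lambda>t. V t - \<i>) \<longlongrightarrow> 0) at_top"
  proof (rule Lim_null_comparison[OF _ tendsto_norm_zero[OF sq]])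
    show "\<forall>\<^sub>F t in at_top. norm (V t - \<i>) \<le> norm ((V t)\<^sup>2 + 1)"
      using eventually_ge_at_top[of 0]
    proof eventually_elim
      fix t :: real assume t: "0 \<le> t"
      have "0 < Im (V t)" using Im_W_pos[OF t] t by (simp add: V_def)
      then have "1 \<le> cmod (V t + \<i>)" using abs_Im_le_cmod[of "V t + \<i>"] by simp
      moreover have "(V t)\<^sup>2 + 1 = (V t - \<i>) * (V t + \<i>)" by (simp add: power2_eq_square algebra_simps)
      ultimately show "norm (V t - \<i>) \<le> norm ((V t)\<^sup>2 + 1)"
        using mult_left_mono[of 1 "cmod (V t + \<i>)" "cmod (V t - \<i>)"] by (simp add: norm_mult)
    qed
  qed
  then show ?thesis unfolding V_def by (rule LIM_zero_cancel)
qed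

text \<open>Solving the fixed point equation for \<open>K (W t)\<close> expresses it through
  \<open>W t / sqrt (1 + t)\<close>, whose limit is known.\<close>

lemma K_scaled_tendsto: "((\<lambda>t. of_real (sqrt (1 + t)) * K (W t)) \<longlongrightarrow> \<i>) at_top"
proof -
  have "((\<lambda>t. of_real ((1 + t) / t) * (W t / of_real (sqrt (1 + t)) - z * of_real (1 / (1 + t))))
      \<longlongrightarrow> of_real 1 * (\<i> - z * of_real 0)) at_top"
  proof (intro tendsto_mult tendsto_diff tendsto_of_real W_scaled_tendsto tendsto_const)
    show "((\<lambda>t::real. (1 + t) / t) \<longlongrightarrow> 1) at_top" by real_asymp
    show "((\<lambda>t::real. 1 / (1 + t)) \<longlongrightarrow> 0) at_top" by real_asymp
  qed
  moreover have "\<forall>\<^sub>F t in at_top. of_real ((1 + t) / t) * (W t / of_real (sqrt (1 + t)) - z * of_real (1 / (1 + t)))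
      = of_real (sqrt (1 + t)) * K (W t)"
    using eventually_ge_at_top[of 1]
  proof eventually_elim
    fix t :: real assume t: "1 \<le> t"
    define c where "c = complex_of_real (sqrt (1 + t))"
    have c: "c \<noteq> 0" "of_real (1 + t) = c * c"
      using t by (auto simp: c_def simp flip: of_real_mult)
    have "of_real t * K (W t) = W t - z / c" using W_eq[of t] t by (simp add: c_def algebra_simps)
    then have K: "K (W t) = (W t - z / c) / of_real t" using t by (simp add: field_simps)
    have "of_real ((1 + t) / t) * (W t / c - z * of_real (1 / (1 + t)))
        = (c * c) / of_real t * (W t / c - z * (1 / (c * c)))"
      by (simp only: of_real_divide of_real_1 c(2))
    also have "\<dots> = c * K (W t)" unfolding K using c(1) t by (simp add: field_simps)
    finally show "of_real ((1 + t) / t) * (W t / of_real (sqrt (1 + t)) - z * of_real (1 / (1 + t)))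
      = of_real (sqrt (1 + t)) * K (W t)" by (simp only: c_def)
  qed
  ultimately have "((\<lambda>t. of_real (sqrt (1 + t)) * K (W t)) \<longlongrightarrow> of_real 1 * (\<i> - z * of_real 0)) at_top"
    by (rule Lim_transform_eventually)
  then show ?thesis by simp
qed

end

end

section \<open>Dilation and the conclusion\<close>

lemma cauchy_transform_dilation:
  assumes "real_distribution N" and c: "0 < c"
  shows "cauchy_transform (dilation c N) z = cauchy_transform N (z / of_real c) / of_real c"
proof -
  interpret real_distribution N by fact
  have "cauchy_transform (dilation c N) z = (\<integral>x. 1 / (z - of_real (c * x)) \<partial>N)"
    unfolding cauchy_transform_def dilation_def by (rule integral_distr) measurable
  also have "\<dots> = (\<integral>x. 1 / (z / of_real c - of_real x) / of_real c \<partial>N)"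
  proof (intro Bochner_Integration.integral_cong refl)
    fix x
    have "z - of_real (c * x) = (z / of_real c - of_real x) * of_real c"
      using c by (simp add: algebra_simps)
    then show "1 / (z - of_real (c * x)) = 1 / (z / of_real c - of_real x) / of_real c" by simp
  qed
  also have "\<dots> = cauchy_transform N (z / of_real c) / of_real c"
    unfolding cauchy_transform_def by (rule integral_divide_zero)
  finally show ?thesis .
qed

theorem corollary1p3:
  fixes \<mu> :: "real measure"
  assumes "real_distribution \<mu>"
    and "integrable \<mu> (\<lambda>x. x)"
    and "integrable \<mu> (\<lambda>x. x\<^sup>2)"
    and "prob_space.expectation \<mu> (\<lambda>x. x) = 0"
    and "prob_space.variance \<mu> (\<lambda>x. x) = 1"
  shows "converges_weakly (\<lambda>t::real. dilation (sqrt (1 + t)) (belinschi_nica t \<mu>))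
           standard_cauchy_distribution at_top"
proof -
  interpret standardized_distribution \<mu>
    using assms by (intro standardized_distribution.intro standardized_distribution_axioms.intro) auto
  let ?N = "\<lambda>t. dilation (sqrt (1 + t)) (belinschi_nica t \<mu>)"
  show ?thesis
  proof (rule converges_weakly_cauchy_transform[OF _ real_distribution_standard_cauchy])
    \<comment> \<open>Only eventually: for \<open>t < 0\<close> the choice operators need not return
      the intended measures.\<close>
    show "\<forall>\<^sub>F t in at_top. real_distribution (?N t)"
      using eventually_ge_at_top[of 0]
    proof eventually_elim
      fix t :: real assume t: "0 \<le> t"
      interpret B: real_distribution "belinschi_nica t \<mu>" by (rule belinschi_nica_F_transform[OF t])
      show "real_distribution (?N t)" unfolding dilation_def by (rule B.real_distribution_distr) simp
    qed
    fix z :: complex assume z: "0 < Im z"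
    have lim: "((\<lambda>t. z + of_real (sqrt (1 + t)) * K (W z t)) \<longlongrightarrow> z + \<i>) at_top"
      by (intro tendsto_intros K_scaled_tendsto[OF z])
    have ne: "z + \<i> \<noteq> 0" using z by (auto simp: complex_eq_iff)
    have "((\<lambda>t. Im (1 / (z + of_real (sqrt (1 + t)) * K (W z t)))) \<longlongrightarrow> Im (1 / (z + \<i>))) at_top"
      by (rule tendsto_Im[OF tendsto_divide[OF tendsto_const lim ne]])
    then have "((\<lambda>t. Im (cauchy_transform (?N t) z)) \<longlongrightarrow> Im (1 / (z + \<i>))) at_top"
    proof (rule Lim_transform_eventually)
      show "\<forall>\<^sub>F t in at_top. Im (1 / (z + of_real (sqrt (1 + t)) * K (W z t))) = Im (cauchy_transform (?N t) z)"
        using eventually_ge_at_top[of 0]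
      proof eventually_elim
        fix t :: real assume t: "0 \<le> t"
        define c where "c = sqrt (1 + t)"
        have c: "0 < c" using t by (simp add: c_def)
        have F: "F_transform (belinschi_nica t \<mu>) (z / of_real c) = z / of_real c + K (W z t)"
          unfolding W_def[OF z] c_def using belinschi_nica_F_transform(2)[OF t Im_scaled_pos[OF z t]] .
        have "cauchy_transform (belinschi_nica t \<mu>) (z / of_real c) = 1 / (z / of_real c + K (W z t))"
          unfolding F[symmetric] by (simp add: F_transform_def)
        then have "cauchy_transform (?N t) z = 1 / (z / of_real c + K (W z t)) / of_real c"
          using cauchy_transform_dilation[OF belinschi_nica_F_transform(1)[OF t] c] by (simp add: c_def)
        \<comment> \<open>The dilation factor turns \<open>z / c + K (W z t)\<close> into
          \<open>z + c * K (W z t)\<close>, the form whose limit \<open>z + \<i>\<close> is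
          available.\<close>
        also have "\<dots> = 1 / (z + of_real c * K (W z t))"
        proof -
          have "(z / of_real c + K (W z t)) * of_real c = z + of_real c * K (W z t)"
            using c by (simp add: distrib_right)
          then show ?thesis by (simp add: divide_divide_eq_left)
        qed
        finally show "Im (1 / (z + of_real (sqrt (1 + t)) * K (W z t))) = Im (cauchy_transform (?N t) z)"
          by (simp add: c_def)
      qed
    qed
    then show "((\<lambda>t. Im (cauchy_transform (?N t) z)) \<longlongrightarrow> Im (cauchy_transform standard_cauchy_distribution z)) at_top"
      using Im_cauchy_transform_standard_cauchy[OF z] by simp
  qed
qed

end
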